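(* Consider a dynamical system on $\mathbb{R}^n$ (a continuous map $f:\mathbb{R}^n\to\mathbb{R}^n$ or a continuous flow $\varphi^t$ on $\mathbb{R}^n$). If there is a compact set $K\subset\mathbb{R}^n$ such that $\emptyset\neq\omega(x)\subset K$ for all $x\in\mathbb{R}^n$, then the dynamical system has a fixed point, i.e. a point $p\in\mathbb{R}^n$ with $f(p)=p$ (respectively, $\varphi^t(p)=p$ for all $t\in\mathbb{R}$).
   Context: A dynamical system on a space $X$ means either a continuous map $f:X\to X$ (not necessarily invertible) or a continuous flow $\varphi^t$ on $X$ (a continuous action $\mathbb{R}\times X\to X$ of the additive group $\mathbb{R}$). $\omega(x)$ denotes the omega limit set of $x$: for a map, $\omega(x)=\bigcap_{N\ge 0}\overline{\{f^k(x):k\ge N\}}$; for a flow, $\omega(x)=\bigcap_{T\ge 0}\overline{\{\varphi^t(x):t\ge T\}}$. *)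

theory Defs
  imports "HOL-Analysis.Analysis"
begin

definition continuous_flow :: "(real \<Rightarrow> 'a::topological_space \<Rightarrow> 'a) \<Rightarrow> bool" where
  "continuous_flow \<phi> \<longleftrightarrow>
     continuous_on UNIV (\<lambda>(t, x). \<phi> t x) \<and>
     (\<forall>x. \<phi> 0 x = x) \<and>
     (\<forall>s t x. \<phi> (s + t) x = \<phi> s (\<phi> t x))"

definition map_omega_limit :: "('a::topological_space \<Rightarrow> 'a) \<Rightarrow> 'a \<Rightarrow> 'a set" where
  "map_omega_limit f x = (\<Inter>N::nat. closure {(f ^^ k) x | k. k \<ge> N})"

definition flow_omega_limit :: "(real \<Rightarrow> 'a::topological_space \<Rightarrow> 'a) \<Rightarrow> 'a \<Rightarrow> 'a set" where
  "flow_omega_limit \<phi> x = (\<Inter>T\<in>{0..}. closure {\<phi> t x | t. t \<ge> T})"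

end

(* The proof is a mod 2 Lefschetz argument on a fine cubical grid.  Compactness turns the pointwise
hypothesis into a cube Q all of whose points are mapped into its interior by all late iterates of f.
On the finite set X of cells met by approximate orbits starting in Q, a cellular approximation of f
gives a chain map M over the field with two elements.  There the Frobenius map is trivial, so
tr M = tr (M^n) for every power n of two; M^n factors through the chains of the contractible cube Q,
hence is chain homotopic to a map of trace 1, and the two boundary terms of the homotopy have equal
traces.  So tr M = 1.  If f had no fixed point, no cell of a fine grid could meet its own image and
tr M would vanish.  For a flow, fixed points of the time 1/n maps accumulate at a rest point. *)

theory Submission
  imports Defs "HOL-Library.Poly_Mapping" "HOL-Library.Z2"
begin

text \<open>Brouwer's theorem for a late iterate, which does map the cube into itself, would give
  only a periodic point. The obstacle is the way back from the iterate to \<open>f\<close>, whose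
  own image of the cube may leave it. The cells on which \<open>f\<close> does act form a complex of
  unknown topology, so its Lefschetz number cannot be computed there directly; the contractible cube
  controls the iterate only. The trace identity over the two-element field bridges this gap, which
  is why the iterate is a power of two. The same coefficients remove orientations and the signs of
  the alternating sum, so a single trace over cells of all dimensions is enough, and it is evaluated
  on chains before any homology is formed. The approximation of \<open>f\<close> takes values in
  boxes rather than in arbitrary unions of cells: a box has an explicit contraction, so the chain
  map can be built cell by cell without simplicial approximation.\<close>

declare add_bit_eq_xor [simp del] mult_bit_eq_and [simp del]

section \<open>Chains modulo two\<close>

type_synonym 'c chain = "'c \<Rightarrow>\<^sub>0 bit"

abbreviation basis :: "'c \<Rightarrow> 'c chain" where
  "basis c \<equiv> Poly_Mapping.single c 1"

text \<open>A chain modulo two is the finite set of its cells, so the extension just sums over the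
  support. It is additive once the values \<open>f c\<close> satisfy
  \<open>f c + f c = 0\<close>.\<close>

definition linext :: "('c \<Rightarrow> 'b::comm_monoid_add) \<Rightarrow> 'c chain \<Rightarrow> 'b" where
  "linext f x = (\<Sum>c\<in>Poly_Mapping.keys x. f c)"

lemma bit_add_self [simp]: "(b::bit) + b = 0"
  by (cases b) auto

lemma chain_add_self [simp]: "(x::'c chain) + x = 0"
  by (rule poly_mapping_eqI) (simp add: lookup_add)

lemma chain_add_self_left [simp]: "(x::'c chain) + (x + y) = y"
  by (simp flip: add.assoc)

lemma chain_keys_iff: "c \<in> Poly_Mapping.keys (x::'c chain) \<longleftrightarrow> Poly_Mapping.lookup x c = 1"
  by (metis bit_not_zero_iff in_keys_iff)

lemma linext_basis [simp]: "linext f (basis c) = f c"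
  by (simp add: linext_def)

lemma linext_superset:
  assumes "finite S" "Poly_Mapping.keys x \<subseteq> S"
  shows "linext f x = (\<Sum>c\<in>S. if Poly_Mapping.lookup x c = 1 then f c else 0)"
proof -
  have "linext f x = (\<Sum>c\<in>Poly_Mapping.keys x. if Poly_Mapping.lookup x c = 1 then f c else 0)"
    unfolding linext_def by (intro sum.cong) (auto simp: chain_keys_iff)
  also have "\<dots> = (\<Sum>c\<in>S. if Poly_Mapping.lookup x c = 1 then f c else 0)"
    using assms by (intro sum.mono_neutral_left) (auto simp: chain_keys_iff)
  finally show ?thesis .
qed

lemma additive_linext:
  assumes "\<And>c. f c + f c = (0::'b::comm_monoid_add)"
  shows "linext f (x + y) = linext f x + linext f y"
proof -
  let ?S = "Poly_Mapping.keys x \<union> Poly_Mapping.keys y"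
  have "linext f (x + y) = (\<Sum>c\<in>?S. if Poly_Mapping.lookup (x + y) c = 1 then f c else 0)"
    by (intro linext_superset) (auto simp: chain_keys_iff lookup_add)
  also have "\<dots> = (\<Sum>c\<in>?S. (if Poly_Mapping.lookup x c = 1 then f c else 0) + (if Poly_Mapping.lookup y c = 1 then f c else 0))"
  proof (intro sum.cong refl)
    fix c
    show "(if Poly_Mapping.lookup (x + y) c = 1 then f c else 0)
      = (if Poly_Mapping.lookup x c = 1 then f c else 0) + (if Poly_Mapping.lookup y c = 1 then f c else 0)"
      by (cases "Poly_Mapping.lookup x c"; cases "Poly_Mapping.lookup y c") (simp_all add: lookup_add assms)
  qed
  also have "\<dots> = linext f x + linext f y"
    by (simp add: sum.distrib linext_superset[of ?S])
  finally show ?thesis .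
qed

lemma additive_linext_chain: "Modules.additive (linext (f :: 'c \<Rightarrow> 'd chain))"
  by (simp add: Modules.additive_def additive_linext)

lemma chain_expand:
  "(x::'c chain) = (\<Sum>c\<in>Poly_Mapping.keys x. basis c)"
proof (rule poly_mapping_eqI)
  fix d
  have "Poly_Mapping.lookup (\<Sum>c\<in>Poly_Mapping.keys x. basis c) d
      = (\<Sum>c\<in>Poly_Mapping.keys x. if c = d then 1 else 0)"
    by (simp add: lookup_sum lookup_single when_def)
  also have "\<dots> = (if d \<in> Poly_Mapping.keys x then 1 else 0)"
    by simp
  also have "\<dots> = Poly_Mapping.lookup x d"
    by (metis bit_not_zero_iff in_keys_iff)
  finally show "Poly_Mapping.lookup x d = Poly_Mapping.lookup (\<Sum>c\<in>Poly_Mapping.keys x. basis c) d" ..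
qed

text \<open>Over the two-element field additivity already is linearity, so
  \<open>Modules.additive\<close> stands for linear maps throughout.\<close>

lemma additive_linext_eq:
  fixes F :: "'c chain \<Rightarrow> 'b::ab_group_add"
  assumes "Modules.additive F"
  shows "F x = linext (\<lambda>c. F (basis c)) x"
proof -
  have "F x = F (\<Sum>c\<in>Poly_Mapping.keys x. basis c)"
    by (rule arg_cong[OF chain_expand])
  then show ?thesis
    by (simp add: additive.sum[OF assms] linext_def)
qed

lemma additive_eqI:
  fixes F G :: "'c chain \<Rightarrow> 'b::ab_group_add"
  assumes "Modules.additive F" "Modules.additive G" "\<And>c. c \<in> Poly_Mapping.keys x \<Longrightarrow> F (basis c) = G (basis c)"
  shows "F x = G x"
  using additive_linext_eq[OF assms(1), of x] additive_linext_eq[OF assms(2), of x] assms(3)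
  by (simp add: linext_def)

lemma additive_eq_zeroI:
  fixes F :: "'c chain \<Rightarrow> 'b::ab_group_add"
  assumes "Modules.additive F" "\<And>c. c \<in> Poly_Mapping.keys x \<Longrightarrow> F (basis c) = 0"
  shows "F x = 0"
  using additive_linext_eq[OF assms(1), of x] assms(2) by (simp add: linext_def)

lemma additive_compose: "Modules.additive F \<Longrightarrow> Modules.additive G \<Longrightarrow> Modules.additive (\<lambda>x. F (G x))"
  by (simp add: Modules.additive_def)

lemma additive_sum_fun:
  fixes F :: "'i \<Rightarrow> 'a::ab_group_add \<Rightarrow> 'b::ab_group_add"
  shows "(\<And>i. i \<in> A \<Longrightarrow> Modules.additive (F i)) \<Longrightarrow> Modules.additive (\<lambda>x. \<Sum>i\<in>A. F i x)"
  by (simp add: Modules.additive_def sum.distrib)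

lemma keys_sum_subset:
  "(\<And>i. i \<in> A \<Longrightarrow> Poly_Mapping.keys (f i) \<subseteq> B) \<Longrightarrow> Poly_Mapping.keys (sum f A) \<subseteq> B"
  by (rule order_trans[OF Poly_Mapping.keys_sum UN_least])

lemma keys_linext_subset:
  assumes "\<And>c. c \<in> Poly_Mapping.keys x \<Longrightarrow> Poly_Mapping.keys (f c) \<subseteq> B"
  shows "Poly_Mapping.keys (linext f x) \<subseteq> B"
  unfolding linext_def using assms by (rule keys_sum_subset)

lemma keys_additive_subset:
  fixes F :: "'c chain \<Rightarrow> 'd chain"
  assumes "Modules.additive F" "\<And>c. c \<in> Poly_Mapping.keys x \<Longrightarrow> Poly_Mapping.keys (F (basis c)) \<subseteq> B"
  shows "Poly_Mapping.keys (F x) \<subseteq> B"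
  unfolding additive_linext_eq[OF assms(1), of x] using assms(2) by (rule keys_linext_subset)

lemma keys_add_subset:
  "Poly_Mapping.keys x \<subseteq> B \<Longrightarrow> Poly_Mapping.keys y \<subseteq> B \<Longrightarrow> Poly_Mapping.keys (x + y) \<subseteq> B"
  using Poly_Mapping.keys_add[of x y] by blast

text \<open>Off the diagonal the terms at (x, y) and (y, x) cancel. This yields both
  \<open>bd_bd\<close> and the invariance of the trace under squaring.\<close>

lemma sum_symmetric_char2:
  fixes g :: "'a \<Rightarrow> 'a \<Rightarrow> 'b::comm_monoid_add"
  assumes "finite A" "\<And>z::'b. z + z = 0" "\<And>x y. x \<in> A \<Longrightarrow> y \<in> A \<Longrightarrow> g x y = g y x"
  shows "(\<Sum>x\<in>A. \<Sum>y\<in>A. g x y) = (\<Sum>x\<in>A. g x x)"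
  using assms(1,3)
proof (induction A)
  case (insert a A)
  have eq: "(\<Sum>x\<in>A. g x a) = (\<Sum>y\<in>A. g a y)"
    using insert.prems by (intro sum.cong) auto
  have "(\<Sum>x\<in>insert a A. \<Sum>y\<in>insert a A. g x y)
      = (g a a + (\<Sum>x\<in>A. g x a)) + ((\<Sum>y\<in>A. g a y) + (\<Sum>x\<in>A. \<Sum>y\<in>A. g x y))"
    using insert.hyps by (simp add: sum.distrib)
  also have "\<dots> = (g a a + (\<Sum>x\<in>A. \<Sum>y\<in>A. g x y)) + ((\<Sum>y\<in>A. g a y) + (\<Sum>y\<in>A. g a y))"
    unfolding eq by (simp only: ac_simps)
  also have "\<dots> = (\<Sum>x\<in>insert a A. g x x)"
    using insert by (simp add: assms(2))
  finally show ?case .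
qed auto

section \<open>Traces\<close>

definition chain_trace :: "'c set \<Rightarrow> ('c chain \<Rightarrow> 'c chain) \<Rightarrow> bit" where
  "chain_trace X T = (\<Sum>c\<in>X. Poly_Mapping.lookup (T (basis c)) c)"

text \<open>\<open>T\<close> acts on an infinite-dimensional space; only its restriction to the
  chains supported in a finite \<open>X\<close> has a trace, and this condition makes the
  restriction exist.\<close>

definition preserves :: "'c set \<Rightarrow> ('c chain \<Rightarrow> 'c chain) \<Rightarrow> bool" where
  "preserves X T \<longleftrightarrow> Modules.additive T \<and> (\<forall>x. Poly_Mapping.keys x \<subseteq> X \<longrightarrow> Poly_Mapping.keys (T x) \<subseteq> X)"

lemma preserves_funpow: "preserves X T \<Longrightarrow> preserves X (T ^^ n)"
  by (induction n) (auto simp: preserves_def Modules.additive_def)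

lemma chain_trace_plus:
  "chain_trace X (\<lambda>x. S x + T x) = chain_trace X S + chain_trace X T"
  by (simp add: chain_trace_def lookup_add sum.distrib)

lemma lookup_additive:
  fixes S :: "'c chain \<Rightarrow> 'd chain"
  assumes "Modules.additive S" "finite X" "Poly_Mapping.keys x \<subseteq> X"
  shows "Poly_Mapping.lookup (S x) c = (\<Sum>d\<in>X. Poly_Mapping.lookup x d * Poly_Mapping.lookup (S (basis d)) c)"
proof -
  have "S x = (\<Sum>d\<in>X. if Poly_Mapping.lookup x d = 1 then S (basis d) else 0)"
    using additive_linext_eq[OF assms(1)] linext_superset[OF assms(2,3)] by metis
  then show ?thesis
    by (auto simp: lookup_sum intro!: sum.cong)
qed

lemma chain_trace_compose:
  assumes "finite X" "preserves X S" "preserves X T"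
  shows "chain_trace X (S \<circ> T) =
    (\<Sum>c\<in>X. \<Sum>d\<in>X. Poly_Mapping.lookup (T (basis c)) d * Poly_Mapping.lookup (S (basis d)) c)"
  unfolding chain_trace_def
  using assms by (intro sum.cong) (auto simp: preserves_def lookup_additive)

lemma chain_trace_commute:
  assumes "finite X" "preserves X S" "preserves X T"
  shows "chain_trace X (S \<circ> T) = chain_trace X (T \<circ> S)"
  using assms by (subst (1 2) chain_trace_compose) (auto simp: mult.commute intro: sum.swap)

text \<open>Over the field with two elements the Frobenius map is the identity, so squaring preserves the trace.\<close>

lemma chain_trace_square:
  assumes "finite X" "preserves X T"
  shows "chain_trace X (T \<circ> T) = chain_trace X T"
proof -
  have idem: "b * b = b" for b :: bit
    by (cases b) auto
  show ?thesis
    unfolding chain_trace_compose[OF assms assms(2)]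
    by (subst sum_symmetric_char2) (auto simp: assms mult.commute idem chain_trace_def)
qed

lemma chain_trace_power2:
  assumes "finite X" "preserves X T"
  shows "chain_trace X (T ^^ (2 ^ k)) = chain_trace X T"
proof (induction k)
  case (Suc k)
  have "T ^^ (2 ^ Suc k) = (T ^^ (2 ^ k)) \<circ> (T ^^ (2 ^ k))"
    by (simp add: mult_2 funpow_add)
  then show ?case
    using Suc chain_trace_square[OF assms(1) preserves_funpow[OF assms(2)]] by metis
qed auto

section \<open>Cubical cells\<close>

text \<open>A cell of the unit cubical grid is coded coordinatewise: an even entry $2k$ stands for
  the point $k$ and an odd entry $2k+1$ for the interval $[k,k+1]$.\<close>

type_synonym 'n cell = "'n \<Rightarrow> int"

definition is_vertex :: "'n cell \<Rightarrow> bool" where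
  "is_vertex c \<longleftrightarrow> (\<forall>i. even (c i))"

text \<open>The boundary is split by direction because the grid complex is a tensor product of
  one-dimensional ones. Modulo two the partial boundaries commute without signs, and a box can be
  contracted one direction at a time.\<close>

definition pbd :: "'n \<Rightarrow> 'n cell chain \<Rightarrow> 'n cell chain" where
  "pbd i = linext (\<lambda>c. if odd (c i) then basis (c(i := c i + 1)) + basis (c(i := c i - 1)) else 0)"

definition bd :: "('n::finite) cell chain \<Rightarrow> 'n cell chain" where
  "bd x = (\<Sum>i\<in>UNIV. pbd i x)"

text \<open>The augmentation: the parity of the number of vertices, which decides whether a
  zero-dimensional chain bounds in a box.\<close>

definition aug :: "'n cell chain \<Rightarrow> bit" where
  "aug = linext (\<lambda>c. of_bool (is_vertex c))"

text \<open>The doubled bounds make a box end at lattice points in every direction, hence closed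
  under faces.\<close>

definition cell_box :: "'n cell \<Rightarrow> 'n cell \<Rightarrow> 'n cell set" where
  "cell_box p q = {c. \<forall>i. 2 * p i \<le> c i \<and> c i \<le> 2 * q i}"

lemma additive_pbd: "Modules.additive (pbd i)"
  unfolding pbd_def by (rule additive_linext_chain)

lemma additive_bd: "Modules.additive (bd :: ('n::finite) cell chain \<Rightarrow> _)"
  unfolding bd_def by (rule additive_sum_fun) (rule additive_pbd)

lemma additive_aug: "Modules.additive aug"
  by (simp add: Modules.additive_def aug_def additive_linext)

lemma pbd_basis:
  "pbd i (basis c) = (if odd (c i) then basis (c(i := c i + 1)) + basis (c(i := c i - 1)) else 0)"
  by (simp add: pbd_def)

lemma aug_basis [simp]: "aug (basis c) = of_bool (is_vertex c)"
  by (simp add: aug_def)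

lemma pbd_commute: "pbd i (pbd j x) = pbd j (pbd i x)"
proof (rule additive_eqI[of "\<lambda>x. pbd i (pbd j x)"])
  fix c
  show "pbd i (pbd j (basis c)) = pbd j (pbd i (basis c))"
    by (cases "i = j") (auto simp: pbd_basis additive.add[OF additive_pbd] additive.zero[OF additive_pbd] fun_upd_twist ac_simps)
qed (rule additive_compose[OF additive_pbd additive_pbd])+

lemma pbd_pbd [simp]: "pbd i (pbd i x) = 0"
proof (rule additive_eq_zeroI[of "\<lambda>x. pbd i (pbd i x)"])
  fix c
  show "pbd i (pbd i (basis c)) = 0"
    by (auto simp: pbd_basis additive.add[OF additive_pbd] additive.zero[OF additive_pbd])
qed (rule additive_compose[OF additive_pbd additive_pbd])+

lemma bd_bd [simp]: "bd (bd x) = 0"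
proof -
  have "bd (bd x) = (\<Sum>i\<in>UNIV. \<Sum>j\<in>UNIV. pbd i (pbd j x))"
    by (simp add: bd_def additive.sum[OF additive_pbd])
  also have "\<dots> = (\<Sum>i\<in>UNIV. pbd i (pbd i x))"
    by (intro sum_symmetric_char2) (auto simp: pbd_commute)
  finally show ?thesis
    by simp
qed

lemma aug_pbd: "aug (pbd i x) = 0"
proof (rule additive_eq_zeroI[of "\<lambda>x. aug (pbd i x)"])
  fix c :: "'a cell"
  have "is_vertex (c(i := c i + 1)) = is_vertex (c(i := c i - 1))" if "odd (c i)"
    using that by (auto simp: is_vertex_def)
  then show "aug (pbd i (basis c)) = 0"
    by (cases "odd (c i)")
       (simp_all only: pbd_basis additive.add[OF additive_aug] additive.zero[OF additive_aug]
          aug_basis if_True if_False simp_thms bit_add_self)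
qed (rule additive_compose[OF additive_aug additive_pbd])

lemma aug_bd [simp]: "aug (bd x) = 0"
  by (simp add: bd_def additive.sum[OF additive_aug] aug_pbd)

definition face_closed :: "'n cell set \<Rightarrow> bool" where
  "face_closed X \<longleftrightarrow> (\<forall>c\<in>X. \<forall>i. odd (c i) \<longrightarrow> c(i := c i + 1) \<in> X \<and> c(i := c i - 1) \<in> X)"

lemma keys_pbd_subset:
  assumes "face_closed X" "Poly_Mapping.keys x \<subseteq> X"
  shows "Poly_Mapping.keys (pbd i x) \<subseteq> X"
proof (rule keys_additive_subset[OF additive_pbd])
  fix c assume "c \<in> Poly_Mapping.keys x"
  then show "Poly_Mapping.keys (pbd i (basis c)) \<subseteq> X"
  proof (cases "odd (c i)")
    case True
    with \<open>c \<in> _\<close> assms have "c(i := c i + 1) \<in> X" "c(i := c i - 1) \<in> X"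
      unfolding face_closed_def by blast+
    then show ?thesis
      using True unfolding pbd_basis by (simp add: keys_add_subset)
  qed (simp add: pbd_basis)
qed

lemma keys_bd_subset:
  assumes "face_closed X" "Poly_Mapping.keys x \<subseteq> X"
  shows "Poly_Mapping.keys (bd x) \<subseteq> X"
  unfolding bd_def by (intro keys_sum_subset keys_pbd_subset assms)

lemma face_closed_box: "face_closed (cell_box p q)"
proof (unfold face_closed_def, intro ballI allI impI)
  fix c i assume c: "c \<in> cell_box p q" and odd: "odd (c i)"
  have "2 * p i \<le> c i" "c i \<le> 2 * q i"
    using c by (auto simp: cell_box_def)
  then have "2 * p i + 1 \<le> c i" "c i + 1 \<le> 2 * q i"
    using odd by presburger+
  then show "c(i := c i + 1) \<in> cell_box p q \<and> c(i := c i - 1) \<in> cell_box p q"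
    using c by (auto simp: cell_box_def)
qed

lemma finite_cell_box: "finite (cell_box p (q :: ('n::finite) cell))"
proof (rule finite_subset)
  show "cell_box p q \<subseteq> (\<Pi>\<^sub>E i\<in>UNIV. {2 * p i..2 * q i})"
    by (auto simp: cell_box_def)
qed (intro finite_PiE, auto)

section \<open>Contracting a box\<close>

text \<open>The prism swept by sliding a cell along direction \<open>i\<close> down to level
  \<open>p i\<close>: a cell flat in that direction sweeps the unit intervals in between, a cell
  extended in it sweeps nothing new.\<close>

definition pcone :: "'n cell \<Rightarrow> 'n \<Rightarrow> 'n cell chain \<Rightarrow> 'n cell chain" where
  "pcone p i = linext (\<lambda>c. if even (c i)
     then \<Sum>j<nat ((c i - 2 * p i) div 2). basis (c(i := 2 * p i + 1 + 2 * int j)) else 0)"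

text \<open>The chain map of the projection to level \<open>p i\<close>; a cell extended in
  direction \<open>i\<close> is flattened to lower dimension and counts as zero.\<close>

definition pproj :: "'n cell \<Rightarrow> 'n \<Rightarrow> 'n cell chain \<Rightarrow> 'n cell chain" where
  "pproj p i = linext (\<lambda>c. if even (c i) then basis (c(i := 2 * p i)) else 0)"

definition proj_on :: "'n cell \<Rightarrow> 'n set \<Rightarrow> 'n cell chain \<Rightarrow> 'n cell chain" where
  "proj_on p I = linext (\<lambda>c. if \<forall>i\<in>I. even (c i) then basis (\<lambda>i. if i \<in> I then 2 * p i else c i) else 0)"

lemma additive_pcone: "Modules.additive (pcone p i)"
  unfolding pcone_def by (rule additive_linext_chain)

lemma additive_pproj: "Modules.additive (pproj p i)"
  unfolding pproj_def by (rule additive_linext_chain)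

lemma additive_proj_on: "Modules.additive (proj_on p I)"
  unfolding proj_on_def by (rule additive_linext_chain)

lemmas zero_simps = additive.zero[OF additive_pbd] additive.zero[OF additive_pcone]
  additive.zero[OF additive_pproj] additive.zero[OF additive_proj_on]
  additive.zero[OF additive_aug] additive.zero[OF additive_bd]

lemmas add_simps = additive.add[OF additive_pbd] additive.add[OF additive_pcone]
  additive.add[OF additive_pproj] additive.add[OF additive_proj_on]
  additive.add[OF additive_aug] additive.add[OF additive_bd]

lemmas sum_simps = additive.sum[OF additive_pbd] additive.sum[OF additive_pcone]
  additive.sum[OF additive_pproj] additive.sum[OF additive_proj_on]
  additive.sum[OF additive_aug] additive.sum[OF additive_bd]

lemma pcone_basis:
  "pcone p i (basis c) = (if even (c i)
     then \<Sum>j<nat ((c i - 2 * p i) div 2). basis (c(i := 2 * p i + 1 + 2 * int j)) else 0)"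
  by (simp add: pcone_def)

lemma sum_telescope_char2:
  fixes g :: "nat \<Rightarrow> 'c chain"
  shows "(\<Sum>j<n. g (Suc j) + g j) = g n + g 0"
proof (induction n)
  case (Suc n)
  then show ?case by (simp add: ac_simps)
qed simp

lemma pbd_pcone_commute:
  assumes "i \<noteq> j"
  shows "pbd j (pcone p i x) = pcone p i (pbd j x)"
proof (rule additive_eqI[of "\<lambda>x. pbd j (pcone p i x)"])
  fix c
  show "pbd j (pcone p i (basis c)) = pcone p i (pbd j (basis c))"
    using assms
    by (auto simp: pbd_basis pcone_basis add_simps zero_simps sum_simps sum.distrib fun_upd_twist)
qed (rule additive_compose[OF additive_pbd additive_pcone] additive_compose[OF additive_pcone additive_pbd])+

lemma pcone_basis_even:
  assumes "c i = 2 * p i + 2 * int n"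
  shows "pcone p i (basis c) = (\<Sum>j<n. basis (c(i := 2 * p i + 1 + 2 * int j)))"
proof -
  have "even (c i)" "nat ((c i - 2 * p i) div 2) = n"
    using assms by simp_all
  then show ?thesis
    by (simp add: pcone_basis)
qed

text \<open>From a point the swept intervals telescope to the point and its projection; for an
  interval the sweeps of its two ends differ by exactly that interval.\<close>

lemma pbd_pcone_same_basis:
  assumes "2 * p i \<le> c i"
  shows "pbd i (pcone p i (basis c)) + pcone p i (pbd i (basis c)) = basis c + pproj p i (basis c)"
proof (cases "even (c i)")
  case True
  then obtain m where m: "c i = 2 * m"
    by (elim evenE)
  define n where "n = nat (m - p i)"
  have ci: "c i = 2 * p i + 2 * int n"
    using assms m by (simp add: n_def)
  define g where "g j = basis (c(i := 2 * p i + 2 * int j))" for j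
  have step: "pbd i (basis (c(i := 2 * p i + 1 + 2 * int j))) = g (Suc j) + g j" for j
  proof -
    have eqs: "2 * p i + 1 + 2 * int j + 1 = 2 * p i + 2 * int (Suc j)"
      "2 * p i + 1 + 2 * int j - 1 = 2 * p i + 2 * int j"
      by simp_all
    have odd: "odd (2 * p i + 1 + 2 * int j)"
      by simp
    show ?thesis
      by (simp only: pbd_basis fun_upd_same fun_upd_upd eqs odd g_def if_True simp_thms)
  qed
  have "pbd i (pcone p i (basis c)) = (\<Sum>j<n. g (Suc j) + g j)"
    unfolding pcone_basis_even[of c i p n, OF ci] sum_simps step ..
  also have "\<dots> = g n + g 0"
    by (rule sum_telescope_char2)
  also have "g n = basis c"
    unfolding g_def ci[symmetric] by simp
  finally show ?thesis
    using True by (simp add: pbd_basis zero_simps pproj_def g_def)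
next
  case False
  then obtain m where m: "c i = 2 * m + 1"
    by (elim oddE)
  define n where "n = nat (m - p i)"
  have ci: "c i = 2 * p i + 1 + 2 * int n"
    using assms m by (simp add: n_def)
  define g where "g j = basis (c(i := 2 * p i + 1 + 2 * int j))" for j
  have up: "pcone p i (basis (c(i := c i + 1))) = (\<Sum>j<Suc n. g j)"
    and down: "pcone p i (basis (c(i := c i - 1))) = (\<Sum>j<n. g j)"
    using pcone_basis_even[of "c(i := c i + 1)" i p "Suc n"] pcone_basis_even[of "c(i := c i - 1)" i p n] ci
    by (simp_all add: g_def)
  have "pcone p i (pbd i (basis c)) = (\<Sum>j<Suc n. g j) + (\<Sum>j<n. g j)"
    using False by (simp only: pbd_basis add_simps up down if_True simp_thms)
  also have "\<dots> = g n"
    by (simp add: ac_simps)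
  also have "g n = basis c"
    unfolding g_def ci[symmetric] by simp
  finally show ?thesis
    using False by (simp add: pcone_basis zero_simps pproj_def)
qed

lemma bd_pcone_homotopy:
  fixes x :: "('n::finite) cell chain"
  assumes "\<And>c. c \<in> Poly_Mapping.keys x \<Longrightarrow> 2 * p i \<le> c i"
  shows "bd (pcone p i x) + pcone p i (bd x) = x + pproj p i x"
proof -
  have "bd (pcone p i x) + pcone p i (bd x) = (\<Sum>j\<in>UNIV. pbd j (pcone p i x) + pcone p i (pbd j x))"
    by (simp add: bd_def sum_simps sum.distrib)
  \<comment> \<open>In every direction other than \<open>i\<close> the two terms are equal, hence
    cancel modulo two.\<close>
  also have "\<dots> = (\<Sum>j\<in>{i}. pbd j (pcone p i x) + pcone p i (pbd j x))"
    by (intro sum.mono_neutral_right) (auto simp: pbd_pcone_commute)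
  also have "\<dots> = pbd i (pcone p i x) + pcone p i (pbd i x)"
    by simp
  also have "\<dots> = x + pproj p i x"
  proof (rule additive_eqI[of "\<lambda>x. pbd i (pcone p i x) + pcone p i (pbd i x)" "\<lambda>x. x + pproj p i x"])
    fix c assume "c \<in> Poly_Mapping.keys x"
    then show "pbd i (pcone p i (basis c)) + pcone p i (pbd i (basis c)) = basis c + pproj p i (basis c)"
      by (intro pbd_pcone_same_basis assms)
  qed (simp_all add: Modules.additive_def add_simps ac_simps)
  finally show ?thesis .
qed

lemma keys_pcone_subset:
  assumes "Poly_Mapping.keys x \<subseteq> cell_box p q"
  shows "Poly_Mapping.keys (pcone p i x) \<subseteq> cell_box p q"
proof (rule keys_additive_subset[OF additive_pcone])
  fix c assume "c \<in> Poly_Mapping.keys x"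
  then have c: "c \<in> cell_box p q"
    using assms by auto
  have "c(i := 2 * p i + 1 + 2 * int j) \<in> cell_box p q"
    if "even (c i)" "j < nat ((c i - 2 * p i) div 2)" for j
  proof -
    have "int j < (c i - 2 * p i) div 2"
      using that(2) by linarith
    then have "2 * p i + 1 + 2 * int j \<le> c i"
      by linarith
    moreover have "c i \<le> 2 * q i"
      using c by (simp add: cell_box_def)
    ultimately have "2 * p i + 1 + 2 * int j \<le> 2 * q i"
      by linarith
    then show ?thesis
      using c by (auto simp: cell_box_def)
  qed
  then show "Poly_Mapping.keys (pcone p i (basis c)) \<subseteq> cell_box p q"
    by (auto simp: pcone_basis intro!: keys_sum_subset)
qed

lemma keys_proj_on_subset:
  assumes "Poly_Mapping.keys x \<subseteq> cell_box p q" "\<And>i. p i \<le> q i"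
  shows "Poly_Mapping.keys (proj_on p I x) \<subseteq> cell_box p q"
proof (rule keys_additive_subset[OF additive_proj_on])
  fix c assume "c \<in> Poly_Mapping.keys x"
  then show "Poly_Mapping.keys (proj_on p I (basis c)) \<subseteq> cell_box p q"
    using assms by (auto simp: proj_on_def cell_box_def)
qed

lemma aug_pcone: "aug (pcone p i x) = 0"
proof (rule additive_eq_zeroI[of "\<lambda>x. aug (pcone p i x)"])
  fix c
  have "\<not> is_vertex (c(i := 2 * p i + 1 + 2 * int j))" for j
    by (auto simp: is_vertex_def intro!: exI[of _ i])
  then show "aug (pcone p i (basis c)) = 0"
    by (auto simp: pcone_basis sum_simps zero_simps)
qed (rule additive_compose[OF additive_aug additive_pcone])

lemma pproj_proj_on:
  assumes "i \<notin> I"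
  shows "pproj p i (proj_on p I x) = proj_on p (insert i I) x"
proof (rule additive_eqI[of "\<lambda>x. pproj p i (proj_on p I x)"])
  fix c
  have "(\<lambda>j. if j \<in> I then 2 * p j else c j)(i := 2 * p i) = (\<lambda>j. if j \<in> insert i I then 2 * p j else c j)"
    by auto
  then show "pproj p i (proj_on p I (basis c)) = proj_on p (insert i I) (basis c)"
    using assms by (auto simp: pproj_def proj_on_def additive.zero[OF additive_linext_chain])
qed (rule additive_compose[OF additive_pproj additive_proj_on] additive_proj_on)+

lemma proj_on_homotopy:
  fixes p q :: "('n::finite) cell"
  assumes "finite I" "\<And>i. p i \<le> q i"
  shows "\<exists>h. Modules.additive h \<and> (\<forall>x. Poly_Mapping.keys x \<subseteq> cell_box p q \<longrightarrow>
     Poly_Mapping.keys (h x) \<subseteq> cell_box p q \<and> aug (h x) = 0 \<and> bd (h x) + h (bd x) = x + proj_on p I x)"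
  using assms(1)
proof (induction I)
  case empty
  have "proj_on p {} x = x" for x
    unfolding proj_on_def linext_def by (simp flip: chain_expand)
  then show ?case
    by (intro exI[of _ "\<lambda>x. 0"]) (auto simp: Modules.additive_def zero_simps)
next
  case (insert i I)
  then obtain h where h: "Modules.additive h" and hx: "\<And>x. Poly_Mapping.keys x \<subseteq> cell_box p q \<Longrightarrow>
     Poly_Mapping.keys (h x) \<subseteq> cell_box p q \<and> aug (h x) = 0 \<and> bd (h x) + h (bd x) = x + proj_on p I x"
    by blast
  \<comment> \<open>Homotopies of a composite add up: slide along \<open>I\<close>, then slide the
    projected chain along \<open>i\<close>.\<close>
  let ?h = "\<lambda>x. h x + pcone p i (proj_on p I x)"
  show ?case
  proof (intro exI[of _ ?h] conjI allI impI)
    show "Modules.additive ?h"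
      using h by (simp add: Modules.additive_def add_simps ac_simps)
    fix x :: "'n cell chain" assume x: "Poly_Mapping.keys x \<subseteq> cell_box p q"
    have Dx: "Poly_Mapping.keys (bd x) \<subseteq> cell_box p q"
      by (rule keys_bd_subset[OF face_closed_box x])
    have px: "Poly_Mapping.keys (proj_on p I x) \<subseteq> cell_box p q"
      by (rule keys_proj_on_subset[OF x assms(2)])
    show "Poly_Mapping.keys (?h x) \<subseteq> cell_box p q"
      by (intro keys_add_subset keys_pcone_subset px) (simp add: hx x)
    show "aug (?h x) = 0"
      by (simp add: add_simps aug_pcone hx x)
    have hD: "bd (h x) = h (bd x) + (x + proj_on p I x)"
    proof -
      have "bd (h x) = h (bd x) + (bd (h x) + h (bd x))"
        by (simp add: add.left_commute)
      then show ?thesis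
        using hx[OF x] by simp
    qed
    \<comment> \<open>\<open>bd (h (bd x))\<close> is computed twice, from the relation at
      \<open>bd x\<close> and from the boundary of the relation at \<open>x\<close>; comparing the
      results shows that the projection commutes with \<open>bd\<close>.\<close>
    have "bd (h (bd x)) = bd x + proj_on p I (bd x)"
      using hx[OF Dx] by (simp add: additive.zero[OF h])
    moreover have "bd (h (bd x)) = bd x + bd (proj_on p I x)"
    proof -
      have "bd (h (bd x)) = bd (h (bd x)) + bd (bd (h x))"
        by simp
      also have "\<dots> = bd x + bd (proj_on p I x)"
        by (simp only: hD add_simps chain_add_self_left)
      finally show ?thesis .
    qed
    ultimately have comm: "proj_on p I (bd x) = bd (proj_on p I x)"
      by simp
    have "bd (pcone p i (proj_on p I x)) + pcone p i (bd (proj_on p I x))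
        = proj_on p I x + pproj p i (proj_on p I x)"
      using px by (intro bd_pcone_homotopy) (auto simp: cell_box_def)
    also have "pproj p i (proj_on p I x) = proj_on p (insert i I) x"
      using insert.hyps by (intro pproj_proj_on)
    finally have "bd (?h x) + ?h (bd x) = (bd (h x) + h (bd x)) + (proj_on p I x + proj_on p (insert i I) x)"
      by (simp add: add_simps comm ac_simps)
    also have "\<dots> = x + proj_on p (insert i I) x"
      using hx[OF x] by (simp add: ac_simps)
    finally show "bd (?h x) + ?h (bd x) = x + proj_on p (insert i I) x" .
  qed
qed

text \<open>Collapsing all directions kills every cell but the vertices and moves these to one
  corner, so the total projection is the augmentation times that corner.\<close>

lemma box_contraction:
  fixes p q :: "('n::finite) cell"
  assumes "\<And>i. p i \<le> q i"
  shows "\<exists>h. Modules.additive h \<and> (\<forall>x. Poly_Mapping.keys x \<subseteq> cell_box p q \<longrightarrow>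
     Poly_Mapping.keys (h x) \<subseteq> cell_box p q \<and> aug (h x) = 0 \<and>
     bd (h x) + h (bd x) = x + Poly_Mapping.single (\<lambda>i. 2 * p i) (aug x))"
proof -
  have "proj_on p UNIV x = Poly_Mapping.single (\<lambda>i. 2 * p i) (aug x)" for x
  proof (rule additive_eqI[of "proj_on p UNIV" "\<lambda>x. Poly_Mapping.single (\<lambda>i. 2 * p i) (aug x)"])
    fix c :: "'n cell"
    show "proj_on p UNIV (basis c) = Poly_Mapping.single (\<lambda>i. 2 * p i) (aug (basis c))"
      by (simp add: proj_on_def is_vertex_def)
  qed (auto intro: additive_proj_on simp: Modules.additive_def add_simps single_add)
  then show ?thesis
    using proj_on_homotopy[of UNIV p q] assms by simp
qed

section \<open>Chain maps carried by boxes\<close>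

definition cell_dim :: "('n::finite) cell \<Rightarrow> nat" where
  "cell_dim c = card {i. odd (c i)}"

definition faces :: "'n cell \<Rightarrow> 'n cell set" where
  "faces c = {d. \<exists>i. odd (c i) \<and> (d = c(i := c i + 1) \<or> d = c(i := c i - 1))}"

lemma keys_bd_basis: "Poly_Mapping.keys (bd (basis c)) \<subseteq> faces c"
  unfolding bd_def
proof (rule keys_sum_subset)
  fix i
  show "Poly_Mapping.keys (pbd i (basis c)) \<subseteq> faces c"
  proof (cases "odd (c i)")
    case True
    then have "c(i := c i + 1) \<in> faces c" "c(i := c i - 1) \<in> faces c"
      unfolding faces_def by blast+
    then show ?thesis
      unfolding pbd_basis using True by (simp add: keys_add_subset)
  qed (simp add: pbd_basis)
qed

lemma cell_dim_face:
  assumes "d \<in> faces c"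
  shows "cell_dim d < cell_dim c"
proof -
  obtain i where i: "odd (c i)" "d = c(i := c i + 1) \<or> d = c(i := c i - 1)"
    using assms by (auto simp: faces_def)
  then have "{j. odd (d j)} \<subset> {j. odd (c j)}"
    by (auto split: if_splits)
  then show ?thesis
    unfolding cell_dim_def by (intro psubset_card_mono) auto
qed

text \<open>The method of acyclic carriers: the boxes grow from a face to the cell, so the image of
  the boundary of a cell lies in the box of that cell, and the contraction of this box fills
  it.\<close>

lemma carried_chain_map:
  fixes lo hi :: "('n::finite) cell \<Rightarrow> 'n cell"
  assumes nonempty: "\<And>c i. lo c i \<le> hi c i"
    and mono: "\<And>c d. d \<in> faces c \<Longrightarrow> cell_box (lo d) (hi d) \<subseteq> cell_box (lo c) (hi c)"
  shows "\<exists>M. Modules.additive M \<and> (\<forall>x. bd (M x) = M (bd x)) \<and> (\<forall>x. aug (M x) = aug x) \<and>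
    (\<forall>c. Poly_Mapping.keys (M (basis c)) \<subseteq> cell_box (lo c) (hi c))"
proof -
  define B where "B c = cell_box (lo c) (hi c)" for c
  define good where "good M c \<longleftrightarrow> Poly_Mapping.keys (M (basis c)) \<subseteq> B c \<and>
      bd (M (basis c)) = M (bd (basis c)) \<and> aug (M (basis c)) = aug (basis c)" for M c
  have "\<forall>c. \<exists>h. Modules.additive h \<and> (\<forall>x. Poly_Mapping.keys x \<subseteq> B c \<longrightarrow>
     Poly_Mapping.keys (h x) \<subseteq> B c \<and> aug (h x) = 0 \<and>
     bd (h x) + h (bd x) = x + Poly_Mapping.single (\<lambda>i. 2 * lo c i) (aug x))"
    unfolding B_def by (intro allI box_contraction nonempty)
  then obtain H where addH: "\<And>c. Modules.additive (H c)"
    and H: "\<And>c x. Poly_Mapping.keys x \<subseteq> B c \<Longrightarrow> Poly_Mapping.keys (H c x) \<subseteq> B c \<and> aug (H c x) = 0 \<and>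
     bd (H c x) + H c (bd x) = x + Poly_Mapping.single (\<lambda>i. 2 * lo c i) (aug x)"
    by metis
  have bd_good: "bd (M x) = M (bd x)" and aug_good: "aug (M x) = aug x"
    if add: "Modules.additive M" and good: "\<And>c. c \<in> Poly_Mapping.keys x \<Longrightarrow> good M c" for M x
  proof -
    show "bd (M x) = M (bd x)"
      by (rule additive_eqI[OF additive_compose[OF additive_bd add] additive_compose[OF add additive_bd]])
         (use good in \<open>auto simp: good_def\<close>)
    show "aug (M x) = aug x"
      by (rule additive_eqI[OF additive_compose[OF additive_aug add] additive_aug])
         (use good in \<open>auto simp: good_def\<close>)
  qed
  have "\<exists>M. Modules.additive M \<and> (\<forall>c. cell_dim c \<le> n \<longrightarrow> good M c)" for n
  proof (induction n)
    case 0
    \<comment> \<open>A vertex may go to any vertex of its box; the lower corner is one because the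
      box is nonempty.\<close>
    let ?M = "linext (\<lambda>c. basis (\<lambda>i. 2 * lo c i))"
    have add: "Modules.additive ?M"
      by (rule additive_linext_chain)
    have "good ?M c" if "cell_dim c \<le> 0" for c
    proof -
      have even: "even (c i)" for i
        using that by (auto simp: cell_dim_def)
      have "faces c = {}"
        using even by (auto simp: faces_def)
      then have "bd (basis c) = 0"
        using keys_bd_basis[of c] by simp
      moreover have "bd (basis (\<lambda>i. 2 * lo c i)) = 0"
        by (simp add: bd_def pbd_basis)
      moreover have "(\<lambda>i. 2 * lo c i) \<in> B c"
        using nonempty by (simp add: B_def cell_box_def)
      ultimately show ?thesis
        using even by (simp add: good_def additive.zero[OF add] is_vertex_def)
    qed
    with add show ?case
      by blast
  next
    case (Suc n)
    then obtain M where add: "Modules.additive M" and good: "\<And>c. cell_dim c \<le> n \<Longrightarrow> good M c"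
      by blast
    let ?M = "linext (\<lambda>c. if cell_dim c \<le> n then M (basis c) else H c (M (bd (basis c))))"
    have add': "Modules.additive ?M"
      by (rule additive_linext_chain)
    have eq: "?M x = M x" if "\<And>c. c \<in> Poly_Mapping.keys x \<Longrightarrow> cell_dim c \<le> n" for x
      by (rule additive_eqI[OF add' add]) (simp add: that)
    have eq_bd: "?M (bd (basis c)) = M (bd (basis c))" and dim_bd: "\<And>d. d \<in> Poly_Mapping.keys (bd (basis c)) \<Longrightarrow> cell_dim d \<le> n"
      if "cell_dim c \<le> Suc n" for c
    proof -
      show *: "cell_dim d \<le> n" if "d \<in> Poly_Mapping.keys (bd (basis c))" for d
        using that \<open>cell_dim c \<le> Suc n\<close> keys_bd_basis[of c] cell_dim_face[of d c] by auto
      show "?M (bd (basis c)) = M (bd (basis c))"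
        by (rule eq) (rule *)
    qed
    have "good ?M c" if c: "cell_dim c \<le> Suc n" for c
    proof (cases "cell_dim c \<le> n")
      case True
      then show ?thesis
        using good[OF True] eq_bd[OF c] by (simp add: good_def)
    next
      case False
      define y where "y = M (bd (basis c))"
      have y: "Poly_Mapping.keys y \<subseteq> B c"
        unfolding y_def
      proof (rule keys_additive_subset[OF add])
        fix d assume d: "d \<in> Poly_Mapping.keys (bd (basis c))"
        then have "good M d"
          by (intro good dim_bd[OF c])
        moreover have "B d \<subseteq> B c"
          using mono[of d c] d keys_bd_basis[of c] unfolding B_def by blast
        ultimately show "Poly_Mapping.keys (M (basis d)) \<subseteq> B c"
          by (auto simp: good_def)
      qed
      have goods: "good M d" if "d \<in> Poly_Mapping.keys (bd (basis c))" for d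
        using that by (intro good dim_bd[OF c])
      \<comment> \<open>With \<open>bd y = 0\<close> and \<open>aug y = 0\<close> both correction
        terms of the contraction vanish, so \<open>H c y\<close> has boundary \<open>y\<close>. For
        an edge it is the second equation that matters.\<close>
      have "bd y = 0"
        unfolding y_def using bd_good[OF add goods] by (simp add: additive.zero[OF add])
      moreover have "aug y = 0"
        unfolding y_def using aug_good[OF add goods] by simp
      ultimately have Hy: "bd (H c y) = y" "Poly_Mapping.keys (H c y) \<subseteq> B c" "aug (H c y) = 0"
        using H[OF y] by (simp_all add: additive.zero[OF addH])
      have Mc: "?M (basis c) = H c y"
        using False by (simp add: y_def)
      have "\<not> is_vertex c"
      proof
        assume "is_vertex c"
        then have "{i. odd (c i)} = {}"
          by (simp add: is_vertex_def)
        with False show False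
          by (simp add: cell_dim_def)
      qed
      then show ?thesis
        unfolding good_def Mc eq_bd[OF c] using Hy by (simp add: y_def)
    qed
    with add' show ?case
      by blast
  qed
  from this[of "CARD('n)"] obtain M where M: "Modules.additive M" and "\<And>c. cell_dim c \<le> CARD('n) \<Longrightarrow> good M c"
    by blast
  moreover have "cell_dim (c :: 'n cell) \<le> CARD('n)" for c
    unfolding cell_dim_def by (intro card_mono) auto
  ultimately have good: "good M c" for c
    by blast
  have "Poly_Mapping.keys (M (basis c)) \<subseteq> cell_box (lo c) (hi c)" for c
    using good[of c] unfolding good_def B_def by (rule conjunct1)
  with M bd_good[OF M good] aug_good[OF M good] show ?thesis
    by (intro exI[of _ M] conjI allI)
qed

section \<open>The trace argument for a relation with box values\<close>

lemma keys_funpow_relpow: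
  fixes M :: "'c chain \<Rightarrow> 'c chain"
  assumes add: "Modules.additive M" and M: "\<And>c. Poly_Mapping.keys (M (basis c)) \<subseteq> R `` {c}"
  shows "Poly_Mapping.keys ((M ^^ n) x) \<subseteq> (R ^^ n) `` Poly_Mapping.keys x"
proof (induction n)
  case (Suc n)
  have "Poly_Mapping.keys (M ((M ^^ n) x)) \<subseteq> R `` Poly_Mapping.keys ((M ^^ n) x)"
    by (rule keys_additive_subset[OF add]) (use M in blast)
  also have "\<dots> \<subseteq> R `` ((R ^^ n) `` Poly_Mapping.keys x)"
    by (rule Image_mono[OF order_refl Suc])
  finally show ?case
    by (simp add: relcomp_Image)
qed simp

text \<open>A Lefschetz fixed point theorem for \<open>R\<close>. Nothing is known of the topology
  of \<open>X\<close>; the argument rests on its invariance and on its entering, after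
  \<open>2 ^ k\<close> steps, a box that can be contracted.\<close>

lemma cell_in_own_box:
  fixes lo hi :: "('n::finite) cell \<Rightarrow> 'n cell"
  defines "R \<equiv> {(c, d). d \<in> cell_box (lo c) (hi c)}"
  assumes nonempty: "\<And>c i. lo c i \<le> hi c i"
    and mono: "\<And>c d. d \<in> faces c \<Longrightarrow> cell_box (lo d) (hi d) \<subseteq> cell_box (lo c) (hi c)"
    and X: "finite X" "face_closed X" "R `` X \<subseteq> X"
    and Y: "cell_box p q \<subseteq> X" "\<And>i. p i \<le> q i" "(R ^^ (2 ^ k)) `` X \<subseteq> cell_box p q"
  shows "\<exists>c\<in>X. (c, c) \<in> R"
proof (rule ccontr)
  assume no: "\<not> ?thesis"
  obtain M where M: "Modules.additive M \<and> (\<forall>x. bd (M x) = M (bd x)) \<and> (\<forall>x. aug (M x) = aug x) \<and>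
    (\<forall>c. Poly_Mapping.keys (M (basis c)) \<subseteq> cell_box (lo c) (hi c))"
    using carried_chain_map[of lo hi, OF nonempty mono] ..
  have add: "Modules.additive M"
    using M by (rule conjunct1)
  have bdM: "bd (M x) = M (bd x)" and augM: "aug (M x) = aug x" for x
    using M by simp_all
  have keysM: "Poly_Mapping.keys (M (basis c)) \<subseteq> cell_box (lo c) (hi c)" for c
    using M by simp
  have keysR: "Poly_Mapping.keys (M (basis c)) \<subseteq> R `` {c}" for c
    unfolding R_def Image_singleton mem_Collect_eq case_prod_conv Collect_mem_eq by (rule keysM)
  let ?Y = "cell_box p q" and ?N = "M ^^ (2 ^ k)" and ?v = "\<lambda>i. 2 * p i"
  have presM: "preserves X M"
    unfolding preserves_def
  proof (rule conjI[OF add], intro allI impI, rule keys_additive_subset[OF add])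
    fix x :: "'n cell chain" and c assume "Poly_Mapping.keys x \<subseteq> X" "c \<in> Poly_Mapping.keys x"
    then have "R `` {c} \<subseteq> X"
      using X(3) by blast
    with keysR[of c] show "Poly_Mapping.keys (M (basis c)) \<subseteq> X"
      by (rule order_trans)
  qed
  have presN: "preserves X ?N"
    by (rule preserves_funpow[OF presM])
  have addN: "Modules.additive ?N"
    using presN by (simp add: preserves_def)
  have NY: "Poly_Mapping.keys (?N x) \<subseteq> ?Y" if "Poly_Mapping.keys x \<subseteq> X" for x
    using keys_funpow_relpow[OF add keysR, of "2 ^ k" x] that Y(3) by blast
  have bdN: "bd ((M ^^ n) x) = (M ^^ n) (bd x)" for n x
    by (induction n arbitrary: x) (simp_all add: bdM)
  have augN: "aug ((M ^^ n) x) = aug x" for n x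
    by (induction n arbitrary: x) (simp_all add: augM)
  have presD: "preserves X bd"
    unfolding preserves_def using additive_bd keys_bd_subset[OF X(2)] by blast
  obtain h where addh: "Modules.additive h"
    and h: "\<And>x. Poly_Mapping.keys x \<subseteq> ?Y \<Longrightarrow> Poly_Mapping.keys (h x) \<subseteq> ?Y \<and>
      bd (h x) + h (bd x) = x + Poly_Mapping.single ?v (aug x)"
    using box_contraction[of p q] Y(2) by blast
  \<comment> \<open>The relation for \<open>h\<close> holds only in the box, but \<open>?N\<close>
    first brings every chain of \<open>X\<close> there.\<close>
  define T where "T = h \<circ> ?N"
  have presT: "preserves X T"
    unfolding preserves_def
  proof (intro conjI allI impI)
    show "Modules.additive T"
      unfolding T_def comp_def by (rule additive_compose[OF addh addN])
    fix x :: "'n cell chain" assume "Poly_Mapping.keys x \<subseteq> X"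
    then show "Poly_Mapping.keys (T x) \<subseteq> X"
      unfolding T_def comp_def using h[OF NY] Y(1) by blast
  qed
  have v: "?v \<in> X"
    using Y(1,2) by (auto simp: cell_box_def)
  have "chain_trace X M = chain_trace X ?N"
    by (rule chain_trace_power2[OF X(1) presM, symmetric])
  \<comment> \<open>The contraction relation at \<open>?N x\<close>, with \<open>bd\<close> moved
    past \<open>?N\<close>, writes \<open>?N\<close> as a map onto the multiples of
    \<open>?v\<close> plus two boundary terms.\<close>
  also have "\<dots> = chain_trace X (\<lambda>x. Poly_Mapping.single ?v (aug (?N x)) + ((bd \<circ> T) x + (T \<circ> bd) x))"
    unfolding chain_trace_def
  proof (rule sum.cong[OF refl])
    fix c assume "c \<in> X"
    then have "Poly_Mapping.keys (?N (basis c)) \<subseteq> ?Y"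
      by (intro NY) simp
    from h[OF this] have "(bd \<circ> T) (basis c) + (T \<circ> bd) (basis c)
        = Poly_Mapping.single ?v (aug (?N (basis c))) + ?N (basis c)"
      unfolding T_def comp_def bdN by (metis add.commute)
    then show "Poly_Mapping.lookup (?N (basis c)) c = Poly_Mapping.lookup
        (Poly_Mapping.single ?v (aug (?N (basis c))) + ((bd \<circ> T) (basis c) + (T \<circ> bd) (basis c))) c"
      by (simp only: chain_add_self_left)
  qed
  also have "\<dots> = chain_trace X (\<lambda>x. Poly_Mapping.single ?v (aug (?N x)))
      + (chain_trace X (bd \<circ> T) + chain_trace X (T \<circ> bd))"
    by (simp only: chain_trace_plus)
  also have "\<dots> = chain_trace X (\<lambda>x. Poly_Mapping.single ?v (aug (?N x)))"
    by (simp add: chain_trace_commute[OF X(1) presD presT])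
  \<comment> \<open>All columns are multiples of \<open>?v\<close>, so only the diagonal entry at
    \<open>?v\<close> can survive; it is one because \<open>?N\<close> preserves the
    augmentation.\<close>
  also have "\<dots> = (\<Sum>c\<in>X. if c = ?v then 1 else 0)"
    unfolding chain_trace_def augN
    by (intro sum.cong) (auto simp: lookup_single is_vertex_def when_def)
  also have "\<dots> = 1"
    using v X(1) by simp
  finally have "chain_trace X M = 1" .
  moreover have "chain_trace X M = 0"
    unfolding chain_trace_def
  proof (intro sum.neutral ballI)
    fix c assume "c \<in> X"
    then have "c \<notin> Poly_Mapping.keys (M (basis c))"
      using no keysR by blast
    then show "Poly_Mapping.lookup (M (basis c)) c = 0"
      by (simp add: in_keys_iff)
  qed
  ultimately show False
    by simp
qed

section \<open>Absorbing sets\<close>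

lemma continuous_on_funpow:
  assumes "continuous_on UNIV (f :: 'a::topological_space \<Rightarrow> 'a)"
  shows "continuous_on UNIV (f ^^ n)"
proof (induction n)
  case (Suc n)
  then show ?case
    using continuous_on_compose[OF Suc continuous_on_subset[OF assms]] by simp
qed (simp add: id_def)

text \<open>The points that are in \<open>U\<close> at time \<open>k\<close> form an open set for
  each \<open>k\<close>; a finite subcover of \<open>S\<close> bounds the visiting time.\<close>

lemma bounded_visiting_times:
  fixes f :: "'a::topological_space \<Rightarrow> 'a"
  assumes f: "continuous_on UNIV f" and U: "open U" and S: "compact S"
    and visit: "\<And>x. \<exists>k\<ge>1. (f ^^ k) x \<in> U"
  obtains N where "\<And>x. x \<in> S \<Longrightarrow> \<exists>k. 1 \<le> k \<and> k \<le> N \<and> (f ^^ k) x \<in> U"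
proof -
  obtain D where D: "D \<subseteq> {1..}" "finite D" "S \<subseteq> (\<Union>k\<in>D. (f ^^ k) -` U)"
  proof (rule compactE_image[OF S])
    show "open ((f ^^ k) -` U)" for k
      using open_vimage[OF U continuous_on_funpow[OF f]] .
    show "S \<subseteq> (\<Union>k\<in>{1..}. (f ^^ k) -` U)"
      using visit by fastforce
  qed
  obtain N where "D \<subseteq> {..N}"
    using D(2) finite_nat_set_iff_bounded_le by (metis atMost_iff subsetI)
  with D show thesis
    by (intro that[of N]) fastforce
qed

text \<open>\<open>C\<close> is the union of the images of \<open>closure U\<close> up to the bound
  \<open>N\<close> on the return times from it. An orbit about to run past time \<open>N\<close> has
  meanwhile returned to \<open>U\<close> and is counted afresh from there.\<close>

lemma absorbing_compact:
  fixes f :: "'a::heine_borel \<Rightarrow> 'a"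
  assumes f: "continuous_on UNIV f" and U: "open U" "bounded U"
    and visit: "\<And>x. \<exists>k\<ge>1. (f ^^ k) x \<in> U"
  obtains C where "compact C" "U \<subseteq> C" "f ` C \<subseteq> C"
proof -
  obtain N where N: "\<And>x. x \<in> closure U \<Longrightarrow> \<exists>k. 1 \<le> k \<and> k \<le> N \<and> (f ^^ k) x \<in> U"
    using bounded_visiting_times[OF f U(1) _ visit, of "closure U"] U(2) by (metis compact_closure)
  define C where "C = (\<Union>i\<le>N. (f ^^ i) ` closure U)"
  show thesis
  proof
    show "compact C"
      unfolding C_def using U(2)
      by (intro compact_UN compact_continuous_image continuous_on_subset[OF continuous_on_funpow[OF f]])
         (auto simp: compact_closure)
    have CI: "(f ^^ i) x \<in> C" if "i \<le> N" "x \<in> closure U" for i x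
      unfolding C_def using that by blast
    show "U \<subseteq> C"
      using CI[of 0] closure_subset[of U] by auto
    show "f ` C \<subseteq> C"
    proof
      fix y assume "y \<in> f ` C"
      then obtain i x where i: "i \<le> N" and x: "x \<in> closure U" and y: "y = f ((f ^^ i) x)"
        unfolding C_def by blast
      show "y \<in> C"
      proof (cases "i < N")
        case True
        then show ?thesis
          using CI[of "Suc i" x] x y by simp
      next
        case False
        \<comment> \<open>Counting afresh from time \<open>k\<close> leaves \<open>Suc N - k\<close>
          steps, which is at most \<open>N\<close> because \<open>k \<ge> 1\<close>; hence the
          positive visiting times.\<close>
        obtain k where k: "1 \<le> k" "k \<le> N" "(f ^^ k) x \<in> U"
          using N[OF x] by blast
        have "y = (f ^^ (Suc N - k + k)) x"
          using False i k y by simp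
        also have "\<dots> = (f ^^ (Suc N - k)) ((f ^^ k) x)"
          by (simp only: funpow_add comp_apply)
        finally show ?thesis
          using k closure_subset[of U] CI[of "Suc N - k" "(f ^^ k) x"] by auto
      qed
    qed
  qed
qed

lemma funpow_image_subset: "f ` C \<subseteq> C \<Longrightarrow> x \<in> C \<Longrightarrow> (f ^^ n) x \<in> C"
  by (induction n) auto

text \<open>Visits to \<open>U\<close> may be sporadic; as \<open>U\<close> lies in the invariant
  \<open>C\<close>, one visit secures all later times.\<close>

lemma eventually_absorbed:
  fixes f :: "'a::topological_space \<Rightarrow> 'a"
  assumes f: "continuous_on UNIV f" and U: "open U" and S: "compact S"
    and visit: "\<And>x. \<exists>k\<ge>1. (f ^^ k) x \<in> U" and C: "U \<subseteq> C" "f ` C \<subseteq> C"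
  obtains N where "\<And>x j. x \<in> S \<Longrightarrow> j \<ge> N \<Longrightarrow> (f ^^ j) x \<in> C"
proof -
  obtain N where N: "\<And>x. x \<in> S \<Longrightarrow> \<exists>k. 1 \<le> k \<and> k \<le> N \<and> (f ^^ k) x \<in> U"
    using bounded_visiting_times[OF f U S visit] by blast
  have "(f ^^ j) x \<in> C" if x: "x \<in> S" and j: "j \<ge> N" for x j
  proof -
    obtain k where k: "k \<le> N" "(f ^^ k) x \<in> U"
      using N[OF x] by blast
    have "(f ^^ j) x = (f ^^ (j - k)) ((f ^^ k) x)"
      using k(1) j by (simp flip: funpow_add[THEN fun_cong, unfolded comp_apply])
    then show ?thesis
      using k C by (auto intro: funpow_image_subset)
  qed
  then show thesis
    by (rule that)
qed

section \<open>Discretisation\<close>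

text \<open>Halving \<open>c i\<close> and \<open>c i + 1\<close> gives the same integer for a point
  and the two ends for an interval, so one formula covers both codes.\<close>

definition cell_points :: "real \<Rightarrow> ('n::finite) cell \<Rightarrow> (real ^ 'n) set" where
  "cell_points \<eta> c = cbox (\<chi> i. \<eta> * of_int (c i div 2)) (\<chi> i. \<eta> * of_int ((c i + 1) div 2))"

text \<open>With \<open>cell_hi\<close>, the corners of the smallest grid box containing the image
  of the cell. Such values are contractible and grow from a face to the cell, as carriers
  must.\<close>

definition cell_lo :: "(real ^ 'n \<Rightarrow> real ^ 'n) \<Rightarrow> real \<Rightarrow> ('n::finite) cell \<Rightarrow> 'n cell" where
  "cell_lo f \<eta> c = (\<lambda>i. \<lfloor>(INF x\<in>cell_points \<eta> c. f x $ i) / \<eta>\<rfloor>)"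

definition cell_hi :: "(real ^ 'n \<Rightarrow> real ^ 'n) \<Rightarrow> real \<Rightarrow> ('n::finite) cell \<Rightarrow> 'n cell" where
  "cell_hi f \<eta> c = (\<lambda>i. \<lceil>(SUP x\<in>cell_points \<eta> c. f x $ i) / \<eta>\<rceil>)"

definition cell_rel :: "(real ^ 'n \<Rightarrow> real ^ 'n) \<Rightarrow> real \<Rightarrow> (('n::finite) cell \<times> 'n cell) set" where
  "cell_rel f \<eta> = {(c, d). d \<in> cell_box (cell_lo f \<eta> c) (cell_hi f \<eta> c)}"

lemma mem_cell_points:
  "x \<in> cell_points \<eta> c \<longleftrightarrow> (\<forall>i. \<eta> * of_int (c i div 2) \<le> x $ i \<and> x $ i \<le> \<eta> * of_int ((c i + 1) div 2))"
  by (simp add: cell_points_def mem_box_cart)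

lemma cell_corner:
  assumes "\<eta> > 0"
  shows "(\<chi> i. \<eta> * of_int (c i div 2)) \<in> cell_points \<eta> c"
    and "(\<chi> i. \<eta> * of_int ((c i + 1) div 2)) \<in> cell_points \<eta> c"
proof -
  have "c i div 2 \<le> (c i + 1) div 2" for i
    by (simp add: zdiv_mono1)
  then have "\<eta> * of_int (c i div 2) \<le> \<eta> * of_int ((c i + 1) div 2)" for i
    using assms by (intro mult_left_mono) auto
  then show "(\<chi> i. \<eta> * of_int (c i div 2)) \<in> cell_points \<eta> c"
    and "(\<chi> i. \<eta> * of_int ((c i + 1) div 2)) \<in> cell_points \<eta> c"
    by (simp_all add: mem_cell_points)
qed

lemma cell_points_nonempty: "\<eta> > 0 \<Longrightarrow> cell_points \<eta> c \<noteq> {}"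
  using cell_corner(1) by blast

lemma cell_points_face:
  assumes "\<eta> > 0" "d \<in> faces c"
  shows "cell_points \<eta> d \<subseteq> cell_points \<eta> c"
proof -
  have "c i div 2 \<le> d i div 2 \<and> (d i + 1) div 2 \<le> (c i + 1) div 2" for i
  proof -
    obtain j where j: "odd (c j)" "d = c(j := c j + 1) \<or> d = c(j := c j - 1)"
      using assms(2) by (auto simp: faces_def)
    show ?thesis
    proof (cases "i = j")
      case True
      then obtain m where "c i = 2 * m + 1"
        using j(1) by (auto elim: oddE)
      then show ?thesis
        using j(2) True by auto
    qed (use j(2) in auto)
  qed
  then have "\<eta> * of_int (c i div 2) \<le> \<eta> * of_int (d i div 2) \<and>
      \<eta> * of_int ((d i + 1) div 2) \<le> \<eta> * of_int ((c i + 1) div 2)" for i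
    using assms(1) by simp
  then show ?thesis
    unfolding subset_iff mem_cell_points by (meson order_trans)
qed

lemma cell_points_diam:
  fixes c :: "('n::finite) cell"
  assumes "\<eta> > 0" "x \<in> cell_points \<eta> c" "y \<in> cell_points \<eta> c"
  shows "dist x y \<le> real CARD('n) * \<eta>"
proof -
  have "\<bar>(x - y) $ i\<bar> \<le> \<eta>" for i
  proof -
    have "(c i + 1) div 2 \<le> c i div 2 + 1"
      by presburger
    then have "real_of_int ((c i + 1) div 2) \<le> real_of_int (c i div 2) + 1"
      by linarith
    then have "\<eta> * of_int ((c i + 1) div 2) \<le> \<eta> * (of_int (c i div 2) + 1)"
      using assms(1) by (intro mult_left_mono) auto
    moreover have "\<eta> * of_int (c i div 2) \<le> x $ i" "x $ i \<le> \<eta> * of_int ((c i + 1) div 2)"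
        "\<eta> * of_int (c i div 2) \<le> y $ i" "y $ i \<le> \<eta> * of_int ((c i + 1) div 2)"
      using assms(2,3) by (auto simp: mem_cell_points)
    ultimately show ?thesis
      by (simp add: algebra_simps abs_le_iff)
  qed
  then have "(\<Sum>i\<in>UNIV. \<bar>(x - y) $ i\<bar>) \<le> real CARD('n) * \<eta>"
    using sum_bounded_above[of UNIV "\<lambda>i. \<bar>(x - y) $ i\<bar>" \<eta>] by simp
  then show ?thesis
    using norm_le_l1_cart[of "x - y"] by (simp add: dist_norm)
qed

lemma bounded_component_image:
  fixes f :: "real ^ 'n \<Rightarrow> real ^ 'n"
  assumes "continuous_on UNIV f"
  shows "bdd_below ((\<lambda>x. f x $ i) ` cell_points \<eta> c)" "bdd_above ((\<lambda>x. f x $ i) ` cell_points \<eta> c)"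
proof -
  have "compact ((\<lambda>x. f x $ i) ` cell_points \<eta> c)"
    unfolding cell_points_def
    by (intro compact_continuous_image continuous_intros continuous_on_subset[OF assms]) auto
  then have "bounded ((\<lambda>x. f x $ i) ` cell_points \<eta> c)"
    by (rule compact_imp_bounded)
  then show "bdd_below ((\<lambda>x. f x $ i) ` cell_points \<eta> c)" "bdd_above ((\<lambda>x. f x $ i) ` cell_points \<eta> c)"
    by (simp_all add: bounded_imp_bdd_below bounded_imp_bdd_above)
qed

lemma cell_lo_le_hi:
  assumes "continuous_on UNIV f" "\<eta> > 0"
  shows "cell_lo f \<eta> c i \<le> cell_hi f \<eta> c i"
proof -
  obtain x where x: "x \<in> cell_points \<eta> c"
    using cell_points_nonempty[OF assms(2)] by blast
  have "(INF x\<in>cell_points \<eta> c. f x $ i) \<le> f x $ i" "f x $ i \<le> (SUP x\<in>cell_points \<eta> c. f x $ i)"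
    using x bounded_component_image[OF assms(1)] by (auto intro: cINF_lower cSUP_upper)
  then have "(INF x\<in>cell_points \<eta> c. f x $ i) / \<eta> \<le> (SUP x\<in>cell_points \<eta> c. f x $ i) / \<eta>"
    using assms(2) by (intro divide_right_mono) auto
  then show ?thesis
    unfolding cell_lo_def cell_hi_def by linarith
qed

lemma cell_box_mono:
  assumes "continuous_on UNIV f" "\<eta> > 0" "d \<in> faces c"
  shows "cell_box (cell_lo f \<eta> d) (cell_hi f \<eta> d) \<subseteq> cell_box (cell_lo f \<eta> c) (cell_hi f \<eta> c)"
proof -
  note sub = cell_points_face[OF assms(2,3)]
  have "cell_lo f \<eta> c i \<le> cell_lo f \<eta> d i" "cell_hi f \<eta> d i \<le> cell_hi f \<eta> c i" for i
    unfolding cell_lo_def cell_hi_def using assms(2)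
    by (auto intro!: floor_mono ceiling_mono divide_right_mono cINF_superset_mono cSUP_subset_mono sub
        cell_points_nonempty bounded_component_image[OF assms(1)])
  then show ?thesis
    unfolding cell_box_def subset_iff mem_Collect_eq
    by (meson mult_left_mono order_trans zero_le_numeral)
qed

text \<open>Rounding outward overshoots the range of a coordinate by at most one grid step, hence
  the extra \<open>\<eta>\<close>.\<close>

lemma cell_rel_close:
  fixes f :: "real ^ 'n \<Rightarrow> real ^ 'n"
  assumes "continuous_on UNIV f" "\<eta> > 0" "(c, d) \<in> cell_rel f \<eta>" "y \<in> cell_points \<eta> d"
    and e: "\<And>u. u \<in> cell_points \<eta> c \<Longrightarrow> \<bar>f u $ i - z\<bar> \<le> e"
  shows "\<bar>y $ i - z\<bar> \<le> e + \<eta>"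
proof -
  let ?I = "INF x\<in>cell_points \<eta> c. f x $ i" and ?S = "SUP x\<in>cell_points \<eta> c. f x $ i"
  note ne = cell_points_nonempty[OF assms(2), of c]
  have "z - e \<le> ?I"
    using e by (intro cINF_greatest ne) (simp add: abs_le_iff algebra_simps)
  moreover have "?S \<le> z + e"
    using e by (intro cSUP_least ne) (simp add: abs_le_iff algebra_simps)
  moreover have "2 * cell_lo f \<eta> c i \<le> d i" "d i \<le> 2 * cell_hi f \<eta> c i"
    using assms(3) by (auto simp: cell_rel_def cell_box_def)
  \<comment> \<open>The bounds on \<open>d i\<close> are even, so both ends of the coded cell obey
    them too.\<close>
  then have "cell_lo f \<eta> c i \<le> d i div 2" "(d i + 1) div 2 \<le> cell_hi f \<eta> c i"
    by presburger+
  then have "\<eta> * of_int (cell_lo f \<eta> c i) \<le> y $ i" "y $ i \<le> \<eta> * of_int (cell_hi f \<eta> c i)"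
    using assms(2,4) unfolding mem_cell_points
    by (meson mult_left_mono of_int_le_iff order_less_imp_le order_trans)+
  moreover have "?I - \<eta> \<le> \<eta> * of_int (cell_lo f \<eta> c i)"
  proof -
    have "\<eta> * (?I / \<eta> - 1) \<le> \<eta> * of_int (cell_lo f \<eta> c i)"
      using assms(2) unfolding cell_lo_def by (intro mult_left_mono) linarith+
    then show ?thesis
      using assms(2) by (simp add: algebra_simps)
  qed
  moreover have "\<eta> * of_int (cell_hi f \<eta> c i) \<le> ?S + \<eta>"
  proof -
    have "\<eta> * of_int (cell_hi f \<eta> c i) \<le> \<eta> * (?S / \<eta> + 1)"
      using assms(2) unfolding cell_hi_def by (intro mult_left_mono) linarith+
    then show ?thesis
      using assms(2) by (simp add: algebra_simps)
  qed
  ultimately show ?thesis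
    by (simp add: abs_le_iff)
qed

lemma cell_rel_tracks:
  fixes f :: "real ^ 'n \<Rightarrow> real ^ 'n"
  assumes f: "continuous_on UNIV f" and A: "compact A" and e: "e > 0"
  shows "\<forall>\<^sub>F \<eta> in at_right 0. \<forall>c d. \<forall>x\<in>A \<inter> cell_points \<eta> c. \<forall>y\<in>cell_points \<eta> d.
    (c, d) \<in> cell_rel f \<eta> \<longrightarrow> dist y (f x) < e"
proof -
  obtain b where b: "\<And>x. x \<in> A \<Longrightarrow> norm x \<le> b"
    using compact_imp_bounded[OF A] unfolding bounded_iff by blast
  let ?n = "real CARD('n)"
  have n: "?n > 0"
    by simp
  \<comment> \<open>A cell that meets \<open>A\<close> may stick out of it; the mesh will keep it
    within distance 1.\<close>
  have "uniformly_continuous_on (cball 0 (b + 1)) f"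
    by (intro compact_uniformly_continuous continuous_on_subset[OF f]) auto
  then obtain \<delta> where \<delta>: "\<delta> > 0"
    "\<And>x u. x \<in> cball 0 (b + 1) \<Longrightarrow> u \<in> cball 0 (b + 1) \<Longrightarrow> dist u x < \<delta> \<Longrightarrow> dist (f u) (f x) < e / (4 * ?n)"
    unfolding uniformly_continuous_on_def using e n by (metis divide_pos_pos mult_pos_pos zero_less_numeral)
  \<comment> \<open>A coordinate errs by \<open>e / (4 * ?n)\<close> from \<open>f\<close> and by
    \<eta> from rounding, so the first bound keeps the sum over coordinates at most
    \<open>e / 2\<close>. The others keep the cell diameter below \<delta> and at most 1.\<close>
  define \<eta>\<^sub>0 where "\<eta>\<^sub>0 = min (e / (4 * ?n)) (min (\<delta> / (2 * ?n)) (1 / ?n))"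
  have "\<eta>\<^sub>0 > 0"
    using \<delta>(1) e n by (simp add: \<eta>\<^sub>0_def)
  have main: "dist y (f x) < e"
    if \<eta>: "0 < \<eta>" "\<eta> < \<eta>\<^sub>0" and x: "x \<in> A" "x \<in> cell_points \<eta> c"
      and y: "y \<in> cell_points \<eta> d" and rel: "(c, d) \<in> cell_rel f \<eta>" for \<eta> c d x y
  proof -
    have n\<eta>: "?n * \<eta> \<le> \<delta> / 2" "?n * \<eta> \<le> 1" "\<eta> \<le> e / (4 * ?n)"
      using \<eta>(2) n by (auto simp: \<eta>\<^sub>0_def field_simps)
    have "\<bar>f u $ i - f x $ i\<bar> \<le> e / (4 * ?n)" if u: "u \<in> cell_points \<eta> c" for u i
    proof -
      have ux: "dist u x \<le> ?n * \<eta>"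
        by (rule cell_points_diam[OF \<eta>(1) u x(2)])
      have nx: "norm x \<le> b"
        by (rule b[OF x(1)])
      have "norm u \<le> b + 1"
        using ux n\<eta>(2) nx norm_triangle_ineq2[of u x] by (simp add: dist_norm)
      then have "dist (f u) (f x) < e / (4 * ?n)"
        using ux n\<eta>(1) \<delta>(1) nx by (intro \<delta>(2)) auto
      moreover have "\<bar>(f u - f x) $ i\<bar> \<le> norm (f u - f x)"
        by (rule component_le_norm_cart)
      ultimately show ?thesis
        by (simp add: dist_norm)
    qed
    then have close: "\<bar>y $ i - f x $ i\<bar> \<le> e / (4 * ?n) + \<eta>" for i
      by (rule cell_rel_close[OF f \<eta>(1) rel y])
    have half: "e / (4 * ?n) + e / (4 * ?n) = e / (2 * ?n)"
      by (simp add: field_simps)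
    have "\<bar>(y - f x) $ i\<bar> \<le> e / (2 * ?n)" for i
      unfolding half[symmetric] vector_minus_component using close[of i] n\<eta>(3) by linarith
    then have "(\<Sum>i\<in>UNIV. \<bar>(y - f x) $ i\<bar>) \<le> ?n * (e / (2 * ?n))"
      using sum_bounded_above[of UNIV "\<lambda>i. \<bar>(y - f x) $ i\<bar>" "e / (2 * ?n)"] by simp
    also have "\<dots> < e"
      using e by simp
    finally show ?thesis
      using norm_le_l1_cart[of "y - f x"] by (simp add: dist_norm)
  qed
  show ?thesis
    unfolding eventually_at_right_field
    using \<open>\<eta>\<^sub>0 > 0\<close> main by (intro exI[of _ \<eta>\<^sub>0]) auto
qed

text \<open>The induction peels off the first step, after which the cell meets a compact
  neighbourhood of the image of \<open>A\<close> that the remaining iterate still sends into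
  \<open>W\<close>. Hence \<open>A\<close> must vary.\<close>

lemma cell_rel_pow_tracks:
  fixes f :: "real ^ 'n \<Rightarrow> real ^ 'n"
  assumes f: "continuous_on UNIV f" and "compact A" "open W" "(f ^^ j) ` A \<subseteq> W"
  shows "\<forall>\<^sub>F \<eta> in at_right 0. \<forall>c d. cell_points \<eta> c \<inter> A \<noteq> {} \<longrightarrow> (c, d) \<in> cell_rel f \<eta> ^^ j \<longrightarrow>
    cell_points \<eta> d \<subseteq> W"
  using assms(2-)
proof (induction j arbitrary: A W)
  case 0
  then obtain e where e: "e > 0" "(\<Union>x\<in>A. ball x e) \<subseteq> W"
    using compact_subset_open_imp_ball_epsilon_subset[of A W] by auto
  let ?n = "real CARD('n)"
  have "cell_points \<eta> c \<subseteq> W"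
    if \<eta>: "0 < \<eta>" "\<eta> < e / ?n" and ne: "cell_points \<eta> c \<inter> A \<noteq> {}" for \<eta> c
  proof
    fix y assume y: "y \<in> cell_points \<eta> c"
    obtain x where x: "x \<in> cell_points \<eta> c" "x \<in> A"
      using ne by blast
    have "dist x y \<le> ?n * \<eta>"
      by (rule cell_points_diam[OF \<eta>(1) x(1) y])
    also have "\<dots> < e"
      using \<eta>(2) by (simp add: field_simps)
    finally have "y \<in> ball x e"
      by simp
    then show "y \<in> W"
      using e(2) x(2) by blast
  qed
  then show ?case
    unfolding eventually_at_right_field using e(1) by (intro exI[of _ "e / ?n"]) auto
next
  case (Suc j)
  have "compact (f ` A)"
    by (intro compact_continuous_image continuous_on_subset[OF f] Suc.prems) auto
  moreover have W1: "open ((f ^^ j) -` W)"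
    using open_vimage[OF Suc.prems(2) continuous_on_funpow[OF f]] .
  moreover have "f ` A \<subseteq> (f ^^ j) -` W"
    using Suc.prems(3) by (auto simp: image_subset_iff funpow_swap1)
  ultimately obtain e where e: "e > 0" "(\<Union>x\<in>f ` A. cball x e) \<subseteq> (f ^^ j) -` W"
    by (rule compact_subset_open_imp_cball_epsilon_subset)
  define B where "B = {x + y | x y. x \<in> f ` A \<and> y \<in> cball 0 e}"
  have B: "compact B"
    unfolding B_def by (intro compact_sums \<open>compact (f ` A)\<close>) auto
  have BI: "y \<in> B" if "x \<in> A" "dist y (f x) < e" for x y
  proof -
    have "y = f x + (y - f x)" "y - f x \<in> cball 0 e"
      using that(2) by (simp_all add: dist_norm norm_minus_commute)
    then show ?thesis
      unfolding B_def using that(1) by blast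
  qed
  have "B \<subseteq> (f ^^ j) -` W"
    using e(2) by (force simp: B_def dist_norm)
  then have "(f ^^ j) ` B \<subseteq> W"
    by blast
  from Suc.IH[OF B Suc.prems(2) this] cell_rel_tracks[OF f Suc.prems(1) e(1)] eventually_at_right_less[of 0]
  show ?case
  proof eventually_elim
    case (elim \<eta>)
    show ?case
    proof (intro allI impI)
      fix c d assume "cell_points \<eta> c \<inter> A \<noteq> {}" and "(c, d) \<in> cell_rel f \<eta> ^^ Suc j"
      then obtain x c' where x: "x \<in> A \<inter> cell_points \<eta> c"
        and c': "(c, c') \<in> cell_rel f \<eta>" "(c', d) \<in> cell_rel f \<eta> ^^ j"
        by (blast dest: relpow_Suc_D2)
      obtain y where y: "y \<in> cell_points \<eta> c'"
        using cell_points_nonempty[OF elim(3)] by blast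
      have "dist y (f x) < e"
        using elim(2) x y c'(1) by blast
      then have "y \<in> B"
        using x BI by blast
      then show "cell_points \<eta> d \<subseteq> W"
        using elim(1) y c'(2) by blast
    qed
  qed
qed

lemma relpow_Image_add: "(R ^^ (i + j)) `` S = (R ^^ j) `` ((R ^^ i) `` S)"
  by (simp add: relpow_add relcomp_Image)

lemma finite_relpow_Image:
  fixes R :: "('a \<times> 'a) set"
  assumes "finite S" "\<And>x. finite (R `` {x})"
  shows "finite ((R ^^ i) `` S)"
proof (induction i)
  case (Suc i)
  have "(R ^^ Suc i) `` S = (\<Union>x\<in>(R ^^ i) `` S. R `` {x})"
    by (auto simp: relcomp_Image)
  then show ?case
    using Suc assms(2) by simp
qed (use assms(1) in simp)

lemma face_closed_UN: "(\<And>a. a \<in> A \<Longrightarrow> face_closed (F a)) \<Longrightarrow> face_closed (\<Union>a\<in>A. F a)"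
  unfolding face_closed_def by blast

lemma cell_rel_Image_singleton: "cell_rel f \<eta> `` {c} = cell_box (cell_lo f \<eta> c) (cell_hi f \<eta> c)"
  unfolding cell_rel_def by blast

lemma face_closed_relpow_Image:
  assumes "face_closed S"
  shows "face_closed ((cell_rel f \<eta> ^^ i) `` S)"
proof (induction i)
  case (Suc i)
  have "(cell_rel f \<eta> ^^ Suc i) `` S = (\<Union>c\<in>(cell_rel f \<eta> ^^ i) `` S. cell_rel f \<eta> `` {c})"
    by (auto simp: relcomp_Image)
  then show ?case
    unfolding cell_rel_Image_singleton by (simp add: face_closed_UN face_closed_box)
qed (use assms in simp)

section \<open>Cubes whose walls lie on the grid\<close>

abbreviation cube :: "real \<Rightarrow> (real ^ 'n) set" where
  "cube r \<equiv> cbox (\<chi> i. - r) (\<chi> i. r)"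

abbreviation open_cube :: "real \<Rightarrow> (real ^ 'n) set" where
  "open_cube r \<equiv> box (\<chi> i. - r) (\<chi> i. r)"

abbreviation cell_cube :: "nat \<Rightarrow> 'n cell set" where
  "cell_cube m \<equiv> cell_box (\<lambda>_. - int m) (\<lambda>_. int m)"

lemma bounded_subset_open_cube:
  assumes "bounded (C :: (real ^ 'n) set)"
  obtains r where "r > 0" "C \<subseteq> open_cube r"
proof -
  obtain b where b: "\<And>x. x \<in> C \<Longrightarrow> norm x \<le> b"
    using assms unfolding bounded_iff by blast
  have "- (\<bar>b\<bar> + 1) < x $ i \<and> x $ i < \<bar>b\<bar> + 1" if "x \<in> C" for x i
    using b[OF that] component_le_norm_cart[of x i] by linarith
  then show thesis
    by (intro that[of "\<bar>b\<bar> + 1"]) (auto simp: mem_box_cart)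
qed

lemma cell_points_cube:
  assumes "r > 0" "m > 0" "c \<in> cell_cube m"
  shows "cell_points (r / real m) c \<subseteq> cube r"
proof
  fix x assume x: "x \<in> cell_points (r / real m) c"
  have "- r \<le> x $ i \<and> x $ i \<le> r" for i
  proof -
    have "- (2 * int m) \<le> c i" "c i \<le> 2 * int m"
      using assms(3) by (auto simp: cell_box_def)
    then have "- int m \<le> c i div 2" "(c i + 1) div 2 \<le> int m"
      by linarith+
    then have "- real m \<le> of_int (c i div 2)" "of_int ((c i + 1) div 2) \<le> real m"
      by linarith+
    note this[THEN mult_left_mono, of "r / real m"]
    moreover have "0 \<le> r / real m"
      using assms(1) by simp
    ultimately have "r / real m * (- real m) \<le> r / real m * of_int (c i div 2)"
      "r / real m * of_int ((c i + 1) div 2) \<le> r / real m * real m"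
      by blast+
    moreover have "r / real m * (- real m) = - r" "r / real m * real m = r"
      using assms(2) by simp_all
    moreover have "r / real m * of_int (c i div 2) \<le> x $ i" "x $ i \<le> r / real m * of_int ((c i + 1) div 2)"
      using x unfolding mem_cell_points by blast+
    ultimately show ?thesis
      by linarith
  qed
  then show "x \<in> cube r"
    by (simp add: mem_box_cart)
qed

text \<open>With mesh \<open>r / real m\<close> the walls are at integer levels, so placing the
  extreme corners of a cell between them is a comparison of integers.\<close>

lemma cell_in_cell_cube:
  assumes "r > 0" "m > 0" "cell_points (r / real m) c \<subseteq> open_cube r"
  shows "c \<in> cell_cube m"
proof -
  have \<eta>: "r / real m > 0"
    using assms by simp
  have "2 * - int m \<le> c i \<and> c i \<le> 2 * int m" for i
  proof -
    have "- r < r / real m * of_int (c i div 2)" "r / real m * of_int ((c i + 1) div 2) < r"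
      using subsetD[OF assms(3) cell_corner(1)[OF \<eta>, of c]] subsetD[OF assms(3) cell_corner(2)[OF \<eta>, of c]]
      by (auto simp: mem_box_cart)
    moreover have "- r = r / real m * (- real m)" "r = r / real m * real m"
      using assms(2) by simp_all
    ultimately have "r / real m * (- real m) < r / real m * of_int (c i div 2)"
      "r / real m * of_int ((c i + 1) div 2) < r / real m * real m"
      by linarith+
    then have "- real m < of_int (c i div 2)" "of_int ((c i + 1) div 2) < real m"
      using \<eta> by (simp_all only: mult_less_cancel_left_pos)
    then have "- int m < c i div 2" "(c i + 1) div 2 < int m"
      by linarith+
    then show ?thesis
      by linarith
  qed
  then show ?thesis
    by (simp add: cell_box_def)
qed

section \<open>Fixed points\<close>

text \<open>What is kept of the omega limits is that every orbit visits a bounded open set at a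
  positive time.\<close>

lemma map_fixed_point:
  fixes f :: "real ^ 'n \<Rightarrow> real ^ 'n"
  assumes f: "continuous_on UNIV f" and U: "open U" "bounded U"
    and visit: "\<And>x. \<exists>k\<ge>1. (f ^^ k) x \<in> U"
  shows "\<exists>p. f p = p"
proof (rule ccontr)
  assume no: "\<not> ?thesis"
  obtain C where C: "compact C" "U \<subseteq> C" "f ` C \<subseteq> C"
    using absorbing_compact[OF f U visit] by blast
  obtain r :: real where r: "r > 0" "C \<subseteq> open_cube r"
    using bounded_subset_open_cube[OF compact_imp_bounded[OF C(1)]] by blast
  let ?Y = "cube r :: (real ^ 'n) set"
  have Y: "compact ?Y"
    by (rule compact_cbox)
  obtain N where N: "\<And>x j. x \<in> ?Y \<Longrightarrow> j \<ge> N \<Longrightarrow> (f ^^ j) x \<in> C"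
    using eventually_absorbed[OF f U(1) Y visit C(2,3)] by blast
  \<comment> \<open>A power of two, as the trace argument requires, that is at least the absorption
    time \<open>N\<close>.\<close>
  define n where "n = (2::nat) ^ N"
  have n: "N \<le> n" "0 < n"
    unfolding n_def using less_exp[of N] by auto
  have "bounded (\<Union>i<n. (f ^^ i) ` ?Y)"
    by (intro compact_imp_bounded compact_UN compact_continuous_image Y
        continuous_on_subset[OF continuous_on_funpow[OF f]]) auto
  then obtain \<rho> where \<rho>: "(\<Union>i<n. (f ^^ i) ` ?Y) \<subseteq> ball 0 \<rho>"
    using bounded_subset_ballD by blast
  \<comment> \<open>Without fixed points the displacement has a positive minimum on the compact
    ball, which will contain all cells of the invariant set.\<close>
  obtain e where e: "e > 0" "\<And>x. x \<in> cball 0 \<rho> \<Longrightarrow> e \<le> dist x (f x)"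
  proof (cases "cball (0 :: real ^ 'n) \<rho> = {}")
    case True
    then show ?thesis
      by (intro that[of 1]) auto
  next
    case False
    obtain x where x: "x \<in> cball 0 \<rho>" "\<And>y. y \<in> cball 0 \<rho> \<Longrightarrow> dist x (f x) \<le> dist y (f y)"
      using continuous_attains_inf[of "cball 0 \<rho>" "\<lambda>x. dist x (f x)"] False
      by (force intro!: continuous_intros continuous_on_subset[OF f])
    show ?thesis
      by (rule that[OF _ x(2)]) (use no in \<open>simp add: eq_commute\<close>)
  qed
  have ev_small: "\<forall>\<^sub>F \<eta> in at_right 0. \<forall>i\<in>{..<n}. \<forall>c d. cell_points \<eta> c \<inter> ?Y \<noteq> {} \<longrightarrow>
      (c, d) \<in> cell_rel f \<eta> ^^ i \<longrightarrow> cell_points \<eta> d \<subseteq> ball 0 \<rho>"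
    using \<rho> by (intro eventually_ball_finite ballI cell_rel_pow_tracks f Y) auto
  \<comment> \<open>The invariant set will consist of cells reached in fewer than \<open>n\<close>
    steps, and \<open>n\<close> further steps must bring them back. The times involved lie between
    \<open>n\<close> and \<open>2 * n\<close>; being finitely many, they admit a common
    mesh.\<close>
  have ev_absorb: "\<forall>\<^sub>F \<eta> in at_right 0. \<forall>j\<in>{n..2 * n}. \<forall>c d. cell_points \<eta> c \<inter> ?Y \<noteq> {} \<longrightarrow>
      (c, d) \<in> cell_rel f \<eta> ^^ j \<longrightarrow> cell_points \<eta> d \<subseteq> open_cube r"
    using N n(1) r(2) by (intro eventually_ball_finite ballI cell_rel_pow_tracks f Y) auto
  have ev_close: "\<forall>\<^sub>F \<eta> in at_right 0. \<forall>c d. \<forall>x\<in>cball 0 \<rho> \<inter> cell_points \<eta> c. \<forall>y\<in>cell_points \<eta> d.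
      (c, d) \<in> cell_rel f \<eta> \<longrightarrow> dist y (f x) < e"
    by (intro cell_rel_tracks f e compact_cball)
  \<comment> \<open>Only the meshes \<open>r / real m\<close> align the grid with the cube.\<close>
  have lim: "filterlim (\<lambda>m. r / real m) (at_right 0) sequentially"
  proof (rule tendsto_imp_filterlim_at_right[OF lim_const_over_n])
    show "\<forall>\<^sub>F m in sequentially. 0 < r / real m"
      using eventually_gt_at_top[of 0] by eventually_elim (use r(1) in simp)
  qed
  have "\<forall>\<^sub>F m in sequentially.
      (\<forall>i\<in>{..<n}. \<forall>c d. cell_points (r / real m) c \<inter> ?Y \<noteq> {} \<longrightarrow>
        (c, d) \<in> cell_rel f (r / real m) ^^ i \<longrightarrow> cell_points (r / real m) d \<subseteq> ball 0 \<rho>) \<and>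
      (\<forall>j\<in>{n..2 * n}. \<forall>c d. cell_points (r / real m) c \<inter> ?Y \<noteq> {} \<longrightarrow>
        (c, d) \<in> cell_rel f (r / real m) ^^ j \<longrightarrow> cell_points (r / real m) d \<subseteq> open_cube r) \<and>
      (\<forall>c d. \<forall>x\<in>cball 0 \<rho> \<inter> cell_points (r / real m) c. \<forall>y\<in>cell_points (r / real m) d.
        (c, d) \<in> cell_rel f (r / real m) \<longrightarrow> dist y (f x) < e) \<and> m > 0"
    by (intro eventually_conj eventually_gt_at_top eventually_compose_filterlim[OF ev_small lim]
        eventually_compose_filterlim[OF ev_absorb lim] eventually_compose_filterlim[OF ev_close lim])
  then obtain m where m: "m > 0"
    and small: "\<And>i c d. i < n \<Longrightarrow> cell_points (r / real m) c \<inter> ?Y \<noteq> {} \<Longrightarrow>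
        (c, d) \<in> cell_rel f (r / real m) ^^ i \<Longrightarrow> cell_points (r / real m) d \<subseteq> ball 0 \<rho>"
    and absorb: "\<And>j c d. n \<le> j \<Longrightarrow> j \<le> 2 * n \<Longrightarrow> cell_points (r / real m) c \<inter> ?Y \<noteq> {} \<Longrightarrow>
        (c, d) \<in> cell_rel f (r / real m) ^^ j \<Longrightarrow> cell_points (r / real m) d \<subseteq> open_cube r"
    and close: "\<And>c d x y. x \<in> cball 0 \<rho> \<Longrightarrow> x \<in> cell_points (r / real m) c \<Longrightarrow>
        y \<in> cell_points (r / real m) d \<Longrightarrow> (c, d) \<in> cell_rel f (r / real m) \<Longrightarrow> dist y (f x) < e"
    unfolding eventually_sequentially by (auto 0 4)
  define \<eta> where "\<eta> = r / real m"
  have \<eta>: "\<eta> > 0"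
    unfolding \<eta>_def using r(1) m by simp
  let ?R = "cell_rel f \<eta>" and ?Q = "cell_cube m :: 'n cell set"
  \<comment> \<open>Stopping before step \<open>n\<close> is enough for invariance, since step
    \<open>n\<close> lands in \<open>?Q\<close> again.\<close>
  define X where "X = (\<Union>i<n. (?R ^^ i) `` ?Q)"
  have meet: "cell_points \<eta> c \<inter> ?Y \<noteq> {}" if "c \<in> ?Q" for c
    using cell_points_cube[OF r(1) m that] cell_points_nonempty[OF \<eta>, of c] unfolding \<eta>_def by blast
  have returns: "(?R ^^ j) `` ?Q \<subseteq> ?Q" if "n \<le> j" "j \<le> 2 * n" for j
  proof
    fix d assume "d \<in> (?R ^^ j) `` ?Q"
    then obtain c where c: "c \<in> ?Q" "(c, d) \<in> ?R ^^ j"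
      by blast
    have "cell_points \<eta> d \<subseteq> open_cube r"
      using absorb[OF that] meet[OF c(1)] c(2) unfolding \<eta>_def by blast
    then show "d \<in> ?Q"
      unfolding \<eta>_def by (rule cell_in_cell_cube[OF r(1) m])
  qed
  have QX: "?Q \<subseteq> X"
    unfolding X_def using n(2) by (intro UN_upper[of 0, THEN order_trans[rotated]]) auto
  have "\<exists>c\<in>X. (c, c) \<in> {(c, d). d \<in> cell_box (cell_lo f \<eta> c) (cell_hi f \<eta> c)}"
  proof (rule cell_in_own_box)
    show "cell_lo f \<eta> c i \<le> cell_hi f \<eta> c i" for c i
      by (rule cell_lo_le_hi[OF f \<eta>])
    show "cell_box (cell_lo f \<eta> d) (cell_hi f \<eta> d) \<subseteq> cell_box (cell_lo f \<eta> c) (cell_hi f \<eta> c)"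
      if "d \<in> faces c" for c d
      by (rule cell_box_mono[OF f \<eta> that])
    show "finite X"
      unfolding X_def
      by (intro finite_UN_I finite_relpow_Image finite_cell_box) (auto simp: cell_rel_Image_singleton finite_cell_box)
    show "face_closed X"
      unfolding X_def by (intro face_closed_UN face_closed_relpow_Image face_closed_box)
    have "?R `` X \<subseteq> X"
    proof
      fix d assume "d \<in> ?R `` X"
      then obtain i where i: "i < n" "d \<in> ?R `` ((?R ^^ i) `` ?Q)"
        unfolding X_def by blast
      then have d: "d \<in> (?R ^^ Suc i) `` ?Q"
        by (simp add: relcomp_Image)
      show "d \<in> X"
      proof (cases "Suc i < n")
        case True
        then show ?thesis
          using d unfolding X_def by blast
      next
        case False
        then have "Suc i = n"
          using i(1) by simp
        then show ?thesis
          using d returns[of n] QX by auto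
      qed
    qed
    then show "{(c, d). d \<in> cell_box (cell_lo f \<eta> c) (cell_hi f \<eta> c)} `` X \<subseteq> X"
      by (simp only: cell_rel_def)
    show "?Q \<subseteq> X"
      by (rule QX)
    show "- int m \<le> int m"
      by simp
    have "(?R ^^ n) `` X \<subseteq> ?Q"
    proof
      fix d assume "d \<in> (?R ^^ n) `` X"
      then obtain i where "i < n" "d \<in> (?R ^^ n) `` ((?R ^^ i) `` ?Q)"
        unfolding X_def by blast
      then show "d \<in> ?Q"
        using returns[of "i + n"] unfolding relpow_Image_add by auto
    qed
    then show "({(c, d). d \<in> cell_box (cell_lo f \<eta> c) (cell_hi f \<eta> c)} ^^ (2 ^ N)) `` X \<subseteq> ?Q"
      by (simp only: cell_rel_def n_def)
  qed
  then obtain c where c: "c \<in> X" "(c, c) \<in> ?R"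
    unfolding cell_rel_def by blast
  obtain i q where i: "i < n" "q \<in> ?Q" "(q, c) \<in> ?R ^^ i"
    using c(1) unfolding X_def by blast
  have "cell_points \<eta> c \<subseteq> ball 0 \<rho>"
    using small[OF i(1)] meet[OF i(2)] i(3) unfolding \<eta>_def by blast
  moreover obtain x where x: "x \<in> cell_points \<eta> c"
    using cell_points_nonempty[OF \<eta>] by blast
  ultimately have "x \<in> cball 0 \<rho>"
    using ball_subset_cball by blast
  \<comment> \<open>As \<open>c\<close> is related to itself, one point \<open>x\<close> serves for
    both the source and the target cell.\<close>
  with close x c(2) have "dist x (f x) < e"
    unfolding \<eta>_def by blast
  moreover have "e \<le> dist x (f x)"
    by (rule e(2)) fact
  ultimately show False
    by simp
qed

text \<open>The bounded set visited by the orbits of the time-\<open>s\<close> map depends on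
  \<open>s\<close>. Moving each fixed point along its orbit into \<open>U\<close> puts all of them
  into one compact set, where a limit exists.\<close>

lemma flow_fixed_point:
  fixes \<phi> :: "real \<Rightarrow> real ^ 'n \<Rightarrow> real ^ 'n"
  assumes flow: "continuous_flow \<phi>" and U: "open U" "bounded U"
    and visit: "\<And>x T. \<exists>t\<ge>T. \<phi> t x \<in> U"
  shows "\<exists>p. \<forall>t. \<phi> t p = p"
proof -
  have cont: "continuous_on UNIV (\<lambda>(t, x). \<phi> t x)" and zero: "\<phi> 0 x = x" and add: "\<phi> (s + t) x = \<phi> s (\<phi> t x)" for x s t
    using flow by (auto simp: continuous_flow_def)
  have iter: "(\<phi> s ^^ k) x = \<phi> (real k * s) x" for s k x
    by (induction k) (simp_all add: zero add algebra_simps flip: add)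
  have iter_fixed: "\<phi> (real k * s) x = x" if "\<phi> s x = x" for s k x
    unfolding iter[symmetric] using that by (induction k) simp_all
  have periodic: "\<phi> (of_int m * s) x = x" if "\<phi> s x = x" for s m x
  proof (cases "m \<ge> 0")
    case True
    then show ?thesis
      using iter_fixed[OF that, of "nat m"] by simp
  next
    case False
    have "\<phi> (of_int m * s) (\<phi> (real (nat (- m)) * s) x) = x"
      using False by (simp add: zero flip: add)
    then show ?thesis
      by (simp only: iter_fixed[OF that])
  qed
  have cont_time: "continuous_on UNIV (\<phi> s)" for s
    using continuous_on_compose2[OF cont, of UNIV "\<lambda>x. (s, x)"] by (simp add: continuous_on_Pair continuous_on_const continuous_on_id)
  have ex: "\<exists>p\<in>closure U. \<phi> s p = p" if s: "s > 0" for s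
  proof -
    \<comment> \<open>A visit to \<open>U\<close> occurs at a real time; flowing back by less than
      \<open>s\<close> reaches a multiple of \<open>s\<close>, so the discrete orbit visits
      \<open>W\<close>.\<close>
    define W where "W = (\<lambda>(t, x). \<phi> t x) ` ({-s..0} \<times> closure U)"
    have "compact W"
      unfolding W_def using U(2)
      by (intro compact_continuous_image continuous_on_subset[OF cont] compact_Times) (auto simp: compact_closure)
    then obtain b where b: "W \<subseteq> ball 0 b"
      using compact_imp_bounded bounded_subset_ballD by blast
    have "\<exists>k\<ge>1. (\<phi> s ^^ k) x \<in> ball 0 b" for x
    proof -
      \<comment> \<open>Waiting until \<open>t \<ge> s\<close> makes the number of completed steps
        positive.\<close>
      obtain t where t: "t \<ge> s" "\<phi> t x \<in> U"
        using visit by blast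
      define k where "k = nat \<lfloor>t / s\<rfloor>"
      have "1 \<le> t / s"
        using s t(1) by simp
      then have k: "k \<ge> 1" "real k \<le> t / s" "t / s < real k + 1"
        unfolding k_def by linarith+
      have ks: "real k * s \<le> t" "t < real k * s + s"
        using k(2,3) s by (simp_all add: field_simps)
      have "(\<phi> s ^^ k) x = \<phi> (real k * s - t) (\<phi> t x)"
        by (simp add: iter flip: add)
      also have "\<dots> \<in> W"
        unfolding W_def using ks t(2) closure_subset[of U]
        by (intro image_eqI[of _ _ "(real k * s - t, \<phi> t x)"]) auto
      finally show ?thesis
        using k(1) b by blast
    qed
    then obtain p where p: "\<phi> s p = p"
      using map_fixed_point[OF cont_time, of "ball 0 b" s] by auto
    obtain t where t: "\<phi> t p \<in> U"
      using visit by blast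
    \<comment> \<open>The time maps commute, so the whole orbit of \<open>p\<close> is fixed by
      \<open>\<phi> s\<close>.\<close>
    have "\<phi> s (\<phi> t p) = \<phi> t (\<phi> s p)"
      by (simp add: add.commute flip: add)
    then show ?thesis
      using t p closure_subset[of U] by auto
  qed
  have "\<exists>p\<in>closure U. \<phi> (inverse (real (Suc n))) p = p" for n
    by (rule ex) simp
  then obtain P where P: "\<And>n. P n \<in> closure U" "\<And>n. \<phi> (inverse (real (Suc n))) (P n) = P n"
    by metis
  have "compact (closure U)"
    using U(2) by (simp add: compact_closure)
  then obtain p \<sigma> where \<sigma>: "strict_mono \<sigma>" "(P \<circ> \<sigma>) \<longlonglongrightarrow> p"
    using P(1) unfolding compact_def by metis
  have "\<phi> t p = p" for t
  proof -
    define s where "s n = inverse (real (Suc (\<sigma> n)))" for n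
    \<comment> \<open>The last multiple of \<open>s n\<close> not after \<open>t\<close>. There
      \<open>P (\<sigma> n)\<close> is back at itself, and as \<open>a n\<close> tends to
      \<open>t\<close>, joint continuity passes this to the limit.\<close>
    define a where "a n = real_of_int \<lfloor>t / s n\<rfloor> * s n" for n
    have s: "s n > 0" "\<phi> (s n) (P (\<sigma> n)) = P (\<sigma> n)" for n
      unfolding s_def by (simp, rule P(2))
    have s0: "s \<longlonglongrightarrow> 0"
      using LIMSEQ_subseq_LIMSEQ[OF LIMSEQ_inverse_real_of_nat \<sigma>(1)] unfolding s_def comp_def .
    have bound: "\<bar>a n - t\<bar> \<le> s n" for n
    proof -
      have "a n \<le> t / s n * s n" "(t / s n - 1) * s n \<le> a n"
        unfolding a_def using s(1)[of n] by (intro mult_right_mono; linarith)+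
      then show ?thesis
        using s(1)[of n] by (simp add: algebra_simps abs_le_iff)
    qed
    have "(\<lambda>n. a n - t) \<longlonglongrightarrow> 0"
      by (rule Lim_null_comparison[OF _ s0]) (simp add: bound)
    then have "a \<longlonglongrightarrow> t"
      by (simp add: LIM_zero_iff)
    moreover have "(\<lambda>n. P (\<sigma> n)) \<longlonglongrightarrow> p"
      using \<sigma>(2) by (simp add: comp_def)
    ultimately have "(\<lambda>n. (a n, P (\<sigma> n))) \<longlonglongrightarrow> (t, p)"
      by (rule tendsto_Pair)
    then have "(\<lambda>n. \<phi> (a n) (P (\<sigma> n))) \<longlonglongrightarrow> \<phi> t p"
      using continuous_on_tendsto_compose[OF cont, of "\<lambda>n. (a n, P (\<sigma> n))" "(t, p)"] by simp
    moreover have "\<phi> (a n) (P (\<sigma> n)) = P (\<sigma> n)" for n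
      unfolding a_def by (rule periodic[OF s(2)])
    ultimately show ?thesis
      using \<sigma>(2) by (simp add: comp_def LIMSEQ_unique)
  qed
  then show ?thesis
    by blast
qed

theorem corollary3:
  shows "(\<forall>(f :: real ^ 'n \<Rightarrow> real ^ 'n) (K :: (real ^ 'n) set).
            continuous_on UNIV f \<longrightarrow> compact K \<longrightarrow>
            (\<forall>x. map_omega_limit f x \<noteq> {} \<and> map_omega_limit f x \<subseteq> K) \<longrightarrow>
            (\<exists>p. f p = p))
       \<and> (\<forall>(\<phi> :: real \<Rightarrow> real ^ 'n \<Rightarrow> real ^ 'n) (K :: (real ^ 'n) set).
            continuous_flow \<phi> \<longrightarrow> compact K \<longrightarrow>
            (\<forall>x. flow_omega_limit \<phi> x \<noteq> {} \<and> flow_omega_limit \<phi> x \<subseteq> K) \<longrightarrow>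
            (\<exists>p. \<forall>t. \<phi> t p = p))"
proof (intro conjI allI impI)
  fix f :: "real ^ 'n \<Rightarrow> real ^ 'n" and K :: "(real ^ 'n) set"
  assume f: "continuous_on UNIV f" and K: "compact K"
    and \<omega>: "\<forall>x. map_omega_limit f x \<noteq> {} \<and> map_omega_limit f x \<subseteq> K"
  obtain b where b: "K \<subseteq> ball 0 b"
    using compact_imp_bounded[OF K] bounded_subset_ballD by blast
  have "\<exists>k\<ge>1. (f ^^ k) x \<in> ball 0 b" for x
  proof -
    obtain y where y: "y \<in> map_omega_limit f x" "y \<in> ball 0 b"
      using \<omega> b by blast
    \<comment> \<open>Of all tails, the one from time 1 gives a visit at a positive time.\<close>
    then have "y \<in> closure {(f ^^ k) x | k. k \<ge> 1}"
      unfolding map_omega_limit_def by blast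
    then have "ball 0 b \<inter> {(f ^^ k) x | k. k \<ge> 1} \<noteq> {}"
      using y(2) open_Int_closure_eq_empty[OF open_ball] by blast
    then show ?thesis
      by blast
  qed
  then show "\<exists>p. f p = p"
    by (rule map_fixed_point[OF f open_ball bounded_ball])
next
  fix \<phi> :: "real \<Rightarrow> real ^ 'n \<Rightarrow> real ^ 'n" and K :: "(real ^ 'n) set"
  assume flow: "continuous_flow \<phi>" and K: "compact K"
    and \<omega>: "\<forall>x. flow_omega_limit \<phi> x \<noteq> {} \<and> flow_omega_limit \<phi> x \<subseteq> K"
  obtain b where b: "K \<subseteq> ball 0 b"
    using compact_imp_bounded[OF K] bounded_subset_ballD by blast
  have "\<exists>t\<ge>T. \<phi> t x \<in> ball 0 b" for x T
  proof -
    obtain y where y: "y \<in> flow_omega_limit \<phi> x" "y \<in> ball 0 b"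
      using \<omega> b by blast
    \<comment> \<open>The tails that define the limit set start at nonnegative times, hence
      \<open>max T 0\<close>.\<close>
    from y(1) have "y \<in> closure {\<phi> t x | t. t \<ge> max T 0}"
      unfolding flow_omega_limit_def by (elim INT_D) simp
    then have "ball 0 b \<inter> {\<phi> t x | t. t \<ge> max T 0} \<noteq> {}"
      using y(2) open_Int_closure_eq_empty[OF open_ball] by blast
    then show ?thesis
      by auto
  qed
  then show "\<exists>p. \<forall>t. \<phi> t p = p"
    by (rule flow_fixed_point[OF flow open_ball bounded_ball])
qed

end
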